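(* Let $N$ be a positive integer. For $x\in I=[0,1)$ with $N$-continued fraction expansion $x=[a_1,a_2,\dots]_N$, let $\dfrac{A_n}{B_n}=[a_1,a_2,\dots,a_n]_N$ be its $n$-th convergent, without reduction. Then for Lebesgue almost every $x\in I$, $$\lim_{n\to\infty}\frac{\ln B_n}{n}=\Lambda_N+\ln N.$$
   Context: For a positive integer $N$, $T_N:I\to I$ is defined by $T_N(0)=0$ and $T_N(x)=\{N/x\}$ (fractional part) for $x\neq0$. The $N$-continued fraction expansion of $x\in I$ is $x=[a_1,a_2,\dots]_N=\cfrac{N}{a_1+\cfrac{N}{a_2+\ddots}}$, where $a_k=\lfloor N/T_N^{k-1}(x)\rfloor$, with $a_k=\infty$ if $T_N^{k-1}(x)=0$ (which happens for some $k$ only if $x$ is rational). $[a_1,\dots,a_n]_N$ is the truncated continued fraction. "Without reduction" means that $A_n,B_n$ are given by the recursion $A_n=a_nA_{n-1}+NA_{n-2}$, $B_n=a_nB_{n-1}+NB_{n-2}$ for $n\ge1$, with $A_{-1}=1$, $A_0=0$, $B_{-1}=0$, $B_0=1$. The constant $\Lambda_N$ is $$\Lambda_N=\Lambda\!\left(\tfrac1N\right),\qquad \Lambda(x)=\frac{\Theta(x)}{\ln(1+x)},\qquad \Theta(x)=\int_0^x\frac{\ln(t+1)}{t}\,dt=\sum_{k=1}^\infty\frac{(-1)^{k-1}}{k^2}x^k\quad(0<x\le1).$$ *)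

theory Defs
  imports "HOL-Analysis.Analysis" "HOL-Library.Extended_Nat"
begin

definition ncf_map :: "nat \<Rightarrow> real \<Rightarrow> real" where
  "ncf_map N x = (if x = 0 then 0 else frac (real N / x))"

text \<open>Digits are indexed from \<open>k = 1\<close>; the value at \<open>k = 0\<close> is irrelevant.\<close>

definition ncf_digit :: "nat \<Rightarrow> real \<Rightarrow> nat \<Rightarrow> enat" where
  "ncf_digit N x k =
     (let y = (ncf_map N ^^ (k - 1)) x
      in if y = 0 then \<infinity> else enat (nat \<lfloor>real N / y\<rfloor>))"

text \<open>
  The solution of \<open>X\<^sub>n = a\<^sub>n X\<^sub>n\<^sub>-\<^sub>1 + N X\<^sub>n\<^sub>-\<^sub>2\<close> for \<open>n \<ge> 1\<close> with initial values
  \<open>p\<close> at index \<open>-1\<close> and \<open>q\<close> at index \<open>0\<close>.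
\<close>

fun ncf_rec :: "nat \<Rightarrow> (nat \<Rightarrow> nat) \<Rightarrow> nat \<Rightarrow> nat \<Rightarrow> nat \<Rightarrow> nat" where
  "ncf_rec N a p q 0 = q"
| "ncf_rec N a p q (Suc 0) = a 1 * q + N * p"
| "ncf_rec N a p q (Suc (Suc n)) =
     a (Suc (Suc n)) * ncf_rec N a p q (Suc n) + N * ncf_rec N a p q n"

text \<open>
  The unreduced convergents are meaningful as long as \<open>a\<^sub>1, \<dots>, a\<^sub>n\<close> are finite. Once a digit
  is infinite, \<^const>\<open>the_enat\<close> yields an unspecified value; this only
  happens for rational \<open>x\<close>.
\<close>

definition ncf_num :: "nat \<Rightarrow> real \<Rightarrow> nat \<Rightarrow> nat" where
  "ncf_num N x n = ncf_rec N (\<lambda>k. the_enat (ncf_digit N x k)) 1 0 n"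

definition ncf_den :: "nat \<Rightarrow> real \<Rightarrow> nat \<Rightarrow> nat" where
  "ncf_den N x n = ncf_rec N (\<lambda>k. the_enat (ncf_digit N x k)) 0 1 n"

fun ncf_value :: "nat \<Rightarrow> nat list \<Rightarrow> real" where
  "ncf_value N [] = 0"
| "ncf_value N (a # as) = real N / (real a + ncf_value N as)"

definition ncf_convergent :: "nat \<Rightarrow> real \<Rightarrow> nat \<Rightarrow> real" where
  "ncf_convergent N x n = ncf_value N (map (\<lambda>k. the_enat (ncf_digit N x k)) [1..<Suc n])"

text \<open>\<open>\<Theta>\<close> and \<open>\<Lambda>\<close> are used for \<open>0 < x \<le> 1\<close> only.\<close>

definition ncf_Theta :: "real \<Rightarrow> real" where
  "ncf_Theta x = integral {0..x} (\<lambda>t. ln (t + 1) / t)"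

definition ncf_Lambda :: "real \<Rightarrow> real" where
  "ncf_Lambda x = ncf_Theta x / ln (1 + x)"

lemma ncf_rec_fraction:
  fixes t :: real
  assumes "\<And>k. 1 \<le> k \<Longrightarrow> k \<le> n \<Longrightarrow> 0 < a k" and "0 \<le> t"
  shows "foldr (\<lambda>b s. real N / (real b + s)) (map a [1..<Suc n]) t =
      (real (ncf_rec N a 1 0 n) + t * (if n = 0 then 1 else real (ncf_rec N a 1 0 (n - 1)))) /
      (real (ncf_rec N a 0 1 n) + t * (if n = 0 then 0 else real (ncf_rec N a 0 1 (n - 1))))"
  using assms
proof (induction n arbitrary: t)
  case 0
  then show ?case by simp
next
  case (Suc n)
  have a: "0 < real (a (Suc n))" using Suc.prems(1) by simp
  define c where "c = real (a (Suc n)) + t"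
  have c: "0 < c" using a Suc.prems(2) by (simp add: c_def)
  have frac_step: "(u + real N / c * v) / (w + real N / c * z) =
      (c * u + real N * v) / (c * w + real N * z)" for u v w z :: real
  proof -
    have "u + real N / c * v = (c * u + real N * v) / c"
         "w + real N / c * z = (c * w + real N * z) / c"
      using c by (simp_all add: add_divide_distrib)
    then show ?thesis using c by simp
  qed
  have "foldr (\<lambda>b s. real N / (real b + s)) (map a [1..<Suc (Suc n)]) t =
        foldr (\<lambda>b s. real N / (real b + s)) (map a [1..<Suc n]) (real N / c)"
    by (simp add: c_def)
  also have "\<dots> =
      (real (ncf_rec N a 1 0 n) + real N / c * (if n = 0 then 1 else real (ncf_rec N a 1 0 (n - 1)))) /
      (real (ncf_rec N a 0 1 n) + real N / c * (if n = 0 then 0 else real (ncf_rec N a 0 1 (n - 1))))"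
    using Suc.prems c by (intro Suc.IH) auto
  also have "\<dots> =
      (real (ncf_rec N a 1 0 (Suc n)) + t * real (ncf_rec N a 1 0 n)) /
      (real (ncf_rec N a 0 1 (Suc n)) + t * real (ncf_rec N a 0 1 n))"
    unfolding frac_step by (cases n) (simp_all add: c_def algebra_simps)
  finally show ?case by simp
qed

lemma ncf_convergent_eq:
  assumes "\<And>k. 1 \<le> k \<Longrightarrow> k \<le> n \<Longrightarrow> 0 < the_enat (ncf_digit N x k)"
  shows "ncf_convergent N x n = real (ncf_num N x n) / real (ncf_den N x n)"
proof -
  have "ncf_value N as = foldr (\<lambda>b s. real N / (real b + s)) as 0" for as
    by (induction as) simp_all
  then show ?thesis
    using ncf_rec_fraction[of n "\<lambda>k. the_enat (ncf_digit N x k)" 0 N] assms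
    unfolding ncf_convergent_def ncf_num_def ncf_den_def by simp
qed

end

theory Submission imports Defs "HOL-Probability.Probability_Measure" "HOL-Real_Asymp.Real_Asymp" "HOL-Library.Discrete_Functions"
begin

text \<open>
  Let \<open>t\<^sub>k\<close> be the \<open>k\<close>-th point of the orbit of \<open>x\<close>. The recursion for the denominators gives
  \<open>(B\<^sub>n + t\<^sub>n B\<^sub>n\<^sub>-\<^sub>1) t\<^sub>0 \<cdots> t\<^sub>n\<^sub>-\<^sub>1 = N\<^sup>n\<close> (\<open>ncf_den_times_orbit_prod\<close>), and \<open>B\<^sub>n\<^sub>-\<^sub>1 \<le> B\<^sub>n\<close>, so that
  \<open>ln B\<^sub>n\<close> differs by at most \<open>ln 2\<close> from \<open>n ln N\<close> plus the sum of \<open>- ln t\<^sub>k\<close> over \<open>k < n\<close>. What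
  remains is that the orbit averages of \<open>- ln\<close> converge almost everywhere to its mean under the
  Gauss measure, the invariant measure with density \<open>1 / ((N + x) ln (1 + 1 / N))\<close>. That mean
  is \<open>\<Lambda> (1 / N)\<close> by an integration by parts (\<open>ln_kernel_has_integral\<close>).

  The convergence is obtained without the ergodic theorem. The transfer operator of the Gauss
  measure averages a function over the preimages of a point. It turns monotone functions into
  monotone functions of the opposite direction (\<open>ncf_transfer_mono\<close>), and it divides their
  oscillation by at least \<open>N + 1\<close> (\<open>osc_bound_transfer\<close>). One application makes \<open>- ln\<close>
  bounded. Hence the correlations of \<open>- ln\<close> along the orbit decay geometrically
  (\<open>nn_integral_gauss_correlation\<close>), the variance of the \<open>n\<close>-th orbit sum is \<open>O(n)\<close>, and a second
  moment argument along the squares yields almost sure convergence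
  (\<open>strong_law_summable_covariance\<close>).
\<close>

section \<open>A strong law of large numbers for weakly correlated variables\<close>

text \<open>
  Consecutive squares have ratio tending to \<open>1\<close>, so a nondecreasing sequence is controlled
  between them: the average at \<open>n\<close> lies between the averages at the squares around \<open>n\<close>, up to
  factors that tend to \<open>1\<close>.
\<close>

lemma mono_average_tendsto_of_squares:
  fixes S :: "nat \<Rightarrow> real"
  assumes mono: "mono S" and nonneg: "\<And>n. 0 \<le> S n"
    and squares: "(\<lambda>j. S (j\<^sup>2) / real (j\<^sup>2)) \<longlonglongrightarrow> m"
  shows "(\<lambda>n. S n / real n) \<longlonglongrightarrow> m"
proof -
  let ?r = floor_sqrt
  have r: "filterlim ?r at_top sequentially"
    unfolding filterlim_at_top
  proof (intro allI)
    fix Z show "\<forall>\<^sub>F n in sequentially. Z \<le> ?r n"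
      using eventually_ge_at_top[of "Z\<^sup>2"] by eventually_elim (simp add: le_floor_sqrt_iff)
  qed
  have "(\<lambda>j. S (j\<^sup>2) / real (j\<^sup>2) * (real j / real (Suc j))\<^sup>2) \<longlonglongrightarrow> m * 1"
    by (intro tendsto_mult squares) real_asymp
  then have low: "(\<lambda>n. S ((?r n)\<^sup>2) / real ((?r n)\<^sup>2) * (real (?r n) / real (Suc (?r n)))\<^sup>2)
      \<longlonglongrightarrow> m"
    using filterlim_compose[OF _ r] by fastforce
  have "(\<lambda>j. S ((Suc j)\<^sup>2) / real ((Suc j)\<^sup>2) * (real (Suc j) / real j)\<^sup>2) \<longlonglongrightarrow> m * 1"
    using squares by (intro tendsto_mult LIMSEQ_Suc[of "\<lambda>j. S (j\<^sup>2) / real (j\<^sup>2)"]) (assumption, real_asymp)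
  then have up: "(\<lambda>n. S ((Suc (?r n))\<^sup>2) / real ((Suc (?r n))\<^sup>2) * (real (Suc (?r n)) / real (?r n))\<^sup>2)
      \<longlonglongrightarrow> m"
    using filterlim_compose[OF _ r] by fastforce
  show ?thesis
  proof (rule tendsto_sandwich[OF _ _ low up])
    show "\<forall>\<^sub>F n in sequentially. S ((?r n)\<^sup>2) / real ((?r n)\<^sup>2) * (real (?r n) / real (Suc (?r n)))\<^sup>2
        \<le> S n / real n"
      using eventually_ge_at_top[of 1]
    proof eventually_elim
      case (elim n)
      have pos: "0 < ?r n" using elim by simp
      have "S ((?r n)\<^sup>2) / real ((?r n)\<^sup>2) * (real (?r n) / real (Suc (?r n)))\<^sup>2
          = S ((?r n)\<^sup>2) / real ((Suc (?r n))\<^sup>2)"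
        using pos by (simp add: power_divide del: of_nat_Suc)
      also have "\<dots> \<le> S n / real n"
        using elim Suc_floor_sqrt_power2_gt[of n] 
        by (intro frac_le nonneg monoD[OF mono] floor_sqrt_power2_le) (auto simp flip: of_nat_power simp del: of_nat_Suc)
      finally show ?case .
    qed
    show "\<forall>\<^sub>F n in sequentially. S n / real n
        \<le> S ((Suc (?r n))\<^sup>2) / real ((Suc (?r n))\<^sup>2) * (real (Suc (?r n)) / real (?r n))\<^sup>2"
      using eventually_ge_at_top[of 1]
    proof eventually_elim
      case (elim n)
      have pos: "0 < ?r n" using elim by simp
      have "S n / real n \<le> S ((Suc (?r n))\<^sup>2) / real ((?r n)\<^sup>2)"
        using elim pos Suc_floor_sqrt_power2_gt[of n] floor_sqrt_power2_le[of n]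
        by (intro frac_le nonneg monoD[OF mono]) (auto simp flip: of_nat_power simp del: of_nat_Suc)
      also have "\<dots> = S ((Suc (?r n))\<^sup>2) / real ((Suc (?r n))\<^sup>2) * (real (Suc (?r n)) / real (?r n))\<^sup>2"
        using pos by (simp add: power_divide del: of_nat_Suc)
      finally show ?case .
    qed
  qed
qed

text \<open>
  A row sum of the matrix with entries \<open>r \<bar>i - j\<bar>\<close>; each side of the diagonal sees every
  value of \<open>r\<close> at most once.
\<close>

lemma sum_abs_difference_le:
  fixes r :: "nat \<Rightarrow> real"
  assumes r: "summable r" "\<And>k. 0 \<le> r k"
  shows "(\<Sum>j<n. r (if i \<le> j then j - i else i - j)) \<le> 2 * suminf r"
proof -
  have *: "sum (r \<circ> h) A \<le> suminf r" if "finite A" "inj_on h A" for h :: "nat \<Rightarrow> nat" and A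
  proof -
    have "sum (r \<circ> h) A = sum r (h ` A)"
      using that(2) by (simp add: sum.reindex)
    also have "\<dots> \<le> suminf r"
      using that(1) r by (intro sum_le_suminf) auto
    finally show ?thesis .
  qed
  have "(\<Sum>j<n. r (if i \<le> j then j - i else i - j))
      = (\<Sum>j\<in>{..<n} \<inter> {i..}. (r \<circ> (\<lambda>j. j - i)) j) + (\<Sum>j\<in>{..<n} - {i..}. (r \<circ> (\<lambda>j. i - j)) j)"
    by (subst sum.Int_Diff[of _ _ "{i..}"]) (auto intro!: arg_cong2[where f = "(+)"] sum.cong)
  also have "\<dots> \<le> suminf r + suminf r"
    by (intro add_mono *) (auto simp: inj_on_def)
  finally show ?thesis by simp
qed

text \<open>
  A summable one-sided bound on the covariances makes the variance of the \<open>n\<close>-th partial sum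
  \<open>O(n)\<close>, so the averages have variance \<open>O(1/n)\<close>, which is summable along \<open>n = j\<^sup>2\<close>. This
  gives convergence along the squares, and nonnegativity of the \<open>Y i\<close> fills the gaps.
\<close>

lemma (in prob_space) strong_law_summable_covariance:
  fixes Y :: "nat \<Rightarrow> 'a \<Rightarrow> real" and r :: "nat \<Rightarrow> real"
  assumes [measurable]: "\<And>i. Y i \<in> borel_measurable M"
    and nonneg: "\<And>i x. 0 \<le> Y i x"
    and int1: "\<And>i. integrable M (Y i)" and mean: "\<And>i. expectation (Y i) = m"
    and int2: "\<And>i j. i \<le> j \<Longrightarrow> integrable M (\<lambda>x. Y i x * Y j x)"
    and cov: "\<And>i j. i \<le> j \<Longrightarrow> expectation (\<lambda>x. Y i x * Y j x) \<le> m\<^sup>2 + r (j - i)"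
    and r: "summable r" "\<And>k. 0 \<le> r k"
  shows "AE x in M. (\<lambda>n. (\<Sum>i<n. Y i x) / real n) \<longlonglongrightarrow> m"
proof -
  define Z where "Z i x = Y i x - m" for i x
  have [measurable]: "Z i \<in> borel_measurable M" for i
    unfolding Z_def by measurable
  have ZZ: "Z i x * Z j x = Y i x * Y j x - m * Y i x - m * Y j x + m\<^sup>2" for i j x
    by (simp add: Z_def algebra_simps power2_eq_square)
  have int2': "integrable M (\<lambda>x. Y i x * Y j x)" for i j
    using int2[of i j] int2[of j i] by (cases "i \<le> j") (auto simp: mult.commute)
  have intZ: "integrable M (\<lambda>x. Z i x * Z j x)" for i j
    unfolding ZZ by (intro Bochner_Integration.integrable_add Bochner_Integration.integrable_diff int2' integrable_mult_right int1) simp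
  have covZ: "expectation (\<lambda>x. Z i x * Z j x) \<le> r (if i \<le> j then j - i else i - j)" for i j
  proof -
    have "expectation (\<lambda>x. Z i x * Z j x) = expectation (\<lambda>x. Y i x * Y j x) - m\<^sup>2"
      unfolding ZZ using int2'[of i j] int1 mean
      by (simp add: prob_space power2_eq_square)
    then show ?thesis
      using cov[of i j] cov[of j i] by (auto simp: mult.commute)
  qed
  define V where "V n x = ((\<Sum>i<n. Y i x) / real n - m)\<^sup>2" for n x
  have [measurable]: "V n \<in> borel_measurable M" for n
    unfolding V_def by measurable
  have V_nonneg: "0 \<le> V n x" for n x
    by (simp add: V_def)
  have V_eq: "V n x = (\<Sum>i<n. \<Sum>j<n. Z i x * Z j x) / (real n)\<^sup>2" if "n > 0" for n x
  proof -
    have "(\<Sum>i<n. Y i x) / real n - m = (\<Sum>i<n. Z i x) / real n"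
      using that by (simp add: Z_def sum_subtractf field_simps)
    then show ?thesis
      by (simp add: V_def power_divide power2_eq_square sum_product)
  qed
  have V_int: "integrable M (V n)" if "n > 0" for n
    unfolding V_eq[OF that] by (intro integrable_divide_zero Bochner_Integration.integrable_sum intZ)
  have V_le: "expectation (V n) \<le> 2 * suminf r / real n" if "n > 0" for n
  proof -
    have "expectation (V n) = (\<Sum>i<n. \<Sum>j<n. expectation (\<lambda>x. Z i x * Z j x)) / (real n)\<^sup>2"
      unfolding V_eq[OF that] by (simp add: intZ Bochner_Integration.integral_sum)
    also have "\<dots> \<le> (\<Sum>i<n. \<Sum>j<n. r (if i \<le> j then j - i else i - j)) / (real n)\<^sup>2"
      by (intro divide_right_mono sum_mono covZ) simp
    also have "\<dots> \<le> (\<Sum>i<n. 2 * suminf r) / (real n)\<^sup>2"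
      by (intro divide_right_mono sum_mono sum_abs_difference_le r) simp
    also have "\<dots> = 2 * suminf r / real n"
      using that by (simp add: power2_eq_square)
    finally show ?thesis .
  qed
  have R: "0 \<le> suminf r" using r by (intro suminf_nonneg)
  have "(\<integral>\<^sup>+ x. (\<Sum>j. ennreal (V ((Suc j)\<^sup>2) x)) \<partial>M) = (\<Sum>j. \<integral>\<^sup>+ x. ennreal (V ((Suc j)\<^sup>2) x) \<partial>M)"
    by (intro nn_integral_suminf) measurable
  also have "\<dots> = (\<Sum>j. ennreal (expectation (V ((Suc j)\<^sup>2))))"
    by (intro suminf_cong nn_integral_eq_integral V_int AE_I2) (simp_all add: V_nonneg)
  also have "\<dots> \<le> (\<Sum>j. ennreal (2 * suminf r / real ((Suc j)\<^sup>2)))"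
    by (intro suminf_le ennreal_leI V_le) auto
  also have "\<dots> < \<infinity>"
  proof -
    have "summable (\<lambda>j. 2 * suminf r * (1 / real (Suc j)^2))"
      by (intro summable_mult) (use inverse_squares_sums in \<open>auto simp: sums_iff\<close>)
    then have "summable (\<lambda>j. 2 * suminf r / real ((Suc j)\<^sup>2))"
      by simp
    then show ?thesis
      using R by (subst suminf_ennreal2) auto
  qed
  finally have "AE x in M. (\<Sum>j. ennreal (V ((Suc j)\<^sup>2) x)) \<noteq> \<infinity>"
    by (intro nn_integral_noteq_infinite) auto
  then show ?thesis
  proof eventually_elim
    case (elim x)
    have "summable (\<lambda>j. V ((Suc j)\<^sup>2) x)"
      using elim by (intro summable_suminf_not_top) (auto simp: V_nonneg)
    then have "(\<lambda>j. V ((Suc j)\<^sup>2) x) \<longlonglongrightarrow> 0"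
      by (rule summable_LIMSEQ_zero)
    then have "(\<lambda>j. V (j\<^sup>2) x) \<longlonglongrightarrow> 0"
      by (rule LIMSEQ_imp_Suc)
    then have "(\<lambda>j. sqrt (V (j\<^sup>2) x)) \<longlonglongrightarrow> 0"
      using tendsto_real_sqrt by fastforce
    then have "(\<lambda>j. (\<Sum>i<j\<^sup>2. Y i x) / real (j\<^sup>2) - m) \<longlonglongrightarrow> 0"
      unfolding V_def real_sqrt_abs by (rule tendsto_rabs_zero_cancel)
    then have "(\<lambda>j. (\<Sum>i<j\<^sup>2. Y i x) / real (j\<^sup>2)) \<longlonglongrightarrow> m"
      by (simp add: LIM_zero_iff)
    then show ?case
      by (intro mono_average_tendsto_of_squares)
         (auto intro!: monoI sum_mono2 sum_nonneg nonneg)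
  qed
qed

section \<open>Denominators as orbit products\<close>

lemma ncf_orbit_irrational:
  assumes "N > 0" "x \<in> {0<..<1}" "x \<notin> \<rat>"
  shows "(ncf_map N ^^ k) x \<in> {0<..<1} \<and> (ncf_map N ^^ k) x \<notin> \<rat>"
proof (induction k)
  case 0
  show ?case using assms by simp
next
  case (Suc k)
  define y where "y = (ncf_map N ^^ k) x"
  have y: "0 < y" "y < 1" "y \<notin> \<rat>" using Suc by (auto simp: y_def)
  have "real N / y \<notin> \<rat>"
  proof
    assume "real N / y \<in> \<rat>"
    then have "real N / (real N / y) \<in> \<rat>" by (rule Rats_divide[OF Rats_of_nat])
    then show False using y \<open>N > 0\<close> by simp
  qed
  then have irr: "frac (real N / y) \<notin> \<rat>"
    using Rats_add[of "frac (real N / y)" "of_int \<lfloor>real N / y\<rfloor>"] by (auto simp: frac_def)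
  then have "frac (real N / y) \<noteq> 0" by (metis Rats_0)
  moreover have "(ncf_map N ^^ Suc k) x = frac (real N / y)"
    using y(1) by (simp add: ncf_map_def y_def)
  ultimately show ?case
    using irr frac_lt_1[of "real N / y"] frac_ge_0[of "real N / y"] by simp
qed

lemma ncf_digit_irrational:
  assumes "N > 0" "x \<in> {0<..<1}" "x \<notin> \<rat>"
  defines "t \<equiv> \<lambda>k. (ncf_map N ^^ k) x"
  shows "t k * (real (the_enat (ncf_digit N x (Suc k))) + t (Suc k)) = real N"
    and "1 \<le> the_enat (ncf_digit N x (Suc k))"
proof -
  have t: "0 < t k" "t k < 1"
    using ncf_orbit_irrational[OF assms(1-3), of k] by (auto simp: t_def)
  have ge: "1 \<le> real N / t k" using t \<open>N > 0\<close> by (simp add: field_simps)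
  have d: "the_enat (ncf_digit N x (Suc k)) = nat \<lfloor>real N / t k\<rfloor>"
    using t by (simp add: ncf_digit_def t_def)
  have "t (Suc k) = frac (real N / t k)"
    using t by (simp add: t_def ncf_map_def)
  then have "real (the_enat (ncf_digit N x (Suc k))) + t (Suc k) = real N / t k"
    using ge by (simp add: d frac_def)
  then show "t k * (real (the_enat (ncf_digit N x (Suc k))) + t (Suc k)) = real N"
    using t by simp
  show "1 \<le> the_enat (ncf_digit N x (Suc k))"
    using ge unfolding d by linarith
qed

text \<open>
  With \<open>t\<^sub>k\<close> the \<open>k\<close>-th point of the orbit of \<open>x\<close>, the recursion for \<open>B\<^sub>n\<close> and
  \<open>t\<^sub>k (a\<^sub>k\<^sub>+\<^sub>1 + t\<^sub>k\<^sub>+\<^sub>1) = N\<close> show that each step multiplies \<open>B\<^sub>n + t\<^sub>n B\<^sub>n\<^sub>-\<^sub>1\<close> by exactly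
  \<open>N / t\<^sub>n\<close>. The denominators are thereby expressed through the orbit alone.
\<close>

lemma ncf_den_times_orbit_prod:
  assumes "N > 0" "x \<in> {0<..<1}" "x \<notin> \<rat>"
  defines "t \<equiv> \<lambda>k. (ncf_map N ^^ k) x"
  shows "(real (ncf_den N x (Suc n)) + t (Suc n) * real (ncf_den N x n)) * (\<Prod>k<Suc n. t k)
    = real N ^ Suc n"
proof (induction n)
  case 0
  show ?case
    using ncf_digit_irrational(1)[OF assms(1-3), of 0] by (simp add: ncf_den_def t_def mult.commute)
next
  case (Suc n)
  let ?a = "real (the_enat (ncf_digit N x (Suc (Suc n))))"
  let ?B = "\<lambda>n. real (ncf_den N x n)"
  have "(?B (Suc (Suc n)) + t (Suc (Suc n)) * ?B (Suc n)) * t (Suc n)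
      = t (Suc n) * (?a + t (Suc (Suc n))) * ?B (Suc n) + real N * t (Suc n) * ?B n"
    by (simp add: ncf_den_def algebra_simps)
  also have "t (Suc n) * (?a + t (Suc (Suc n))) = real N"
    unfolding t_def by (rule ncf_digit_irrational(1)[OF assms(1-3)])
  also have "real N * ?B (Suc n) + real N * t (Suc n) * ?B n
      = real N * (?B (Suc n) + t (Suc n) * ?B n)"
    by (simp add: algebra_simps)
  finally have step: "(?B (Suc (Suc n)) + t (Suc (Suc n)) * ?B (Suc n)) * t (Suc n)
      = real N * (?B (Suc n) + t (Suc n) * ?B n)" .
  have "(?B (Suc (Suc n)) + t (Suc (Suc n)) * ?B (Suc n)) * (\<Prod>k<Suc (Suc n). t k)
      = ((?B (Suc (Suc n)) + t (Suc (Suc n)) * ?B (Suc n)) * t (Suc n)) * (\<Prod>k<Suc n. t k)"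
    by (simp add: mult_ac)
  also have "\<dots> = real N * ((?B (Suc n) + t (Suc n) * ?B n) * (\<Prod>k<Suc n. t k))"
    unfolding step by (simp add: mult_ac)
  finally show ?case by (simp only: Suc.IH power_Suc)
qed

text \<open>
  Since the digits are at least \<open>1\<close>, the denominators do not decrease, so
  \<open>B\<^sub>n + t\<^sub>n B\<^sub>n\<^sub>-\<^sub>1\<close> exceeds \<open>B\<^sub>n\<close> at most by a factor of \<open>2\<close>.
\<close>

lemma ln_ncf_den_orbit_sum:
  assumes "N > 0" "x \<in> {0<..<1}" "x \<notin> \<rat>"
  shows "\<bar>ln (real (ncf_den N x n)) - (real n * ln (real N) + (\<Sum>k<n. \<bar>ln ((ncf_map N ^^ k) x)\<bar>))\<bar> \<le> ln 2"
proof (cases n)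
  case 0
  then show ?thesis by (simp add: ncf_den_def)
next
  case (Suc l)
  define t where "t = (\<lambda>k. (ncf_map N ^^ k) x)"
  have t: "0 < t k" "t k < 1" for k
    using ncf_orbit_irrational[OF assms, of k] by (auto simp: t_def)
  let ?B = "\<lambda>n. ncf_den N x n"
  have step: "?B k \<le> ?B (Suc k)" for k
  proof -
    have "1 * ?B k \<le> the_enat (ncf_digit N x (Suc k)) * ?B k"
      using ncf_digit_irrational(2)[OF assms] by (rule mult_le_mono1)
    also have "\<dots> \<le> ?B (Suc k)"
      by (cases k) (simp_all add: ncf_den_def)
    finally show ?thesis by simp
  qed
  have "1 \<le> ?B k" for k
  proof (induction k)
    case 0
    show ?case by (simp add: ncf_den_def)
  next
    case (Suc k)
    then show ?case using step[of k] by linarith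
  qed
  then have pos: "0 < real (?B k)" for k
    by (metis of_nat_0_less_iff less_le_trans zero_less_one)
  define Q where "Q = real (?B n) + t n * real (?B l)"
  have Q1: "real (?B n) \<le> Q" using t[of n] by (simp add: Q_def)
  have "t n * real (?B l) \<le> 1 * real (?B n)"
    using t[of n] step[of l] by (intro mult_mono) (auto simp: Suc)
  then have Q2: "Q \<le> 2 * real (?B n)" by (simp add: Q_def)
  have Qpos: "0 < Q" using Q1 pos[of n] by linarith
  have "Q * (\<Prod>k<n. t k) = real N ^ n"
    using ncf_den_times_orbit_prod[OF assms, of l] by (simp only: Q_def t_def Suc)
  then have "ln (Q * (\<Prod>k<n. t k)) = real n * ln (real N)"
    using \<open>N > 0\<close> by (simp add: ln_realpow)
  moreover have "ln (Q * (\<Prod>k<n. t k)) = ln Q + (\<Sum>k<n. ln (t k))"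
    using Qpos t by (simp add: ln_mult_pos prod_pos ln_prod less_imp_neq[symmetric])
  moreover have "(\<Sum>k<n. \<bar>ln (t k)\<bar>) = - (\<Sum>k<n. ln (t k))"
    unfolding sum_negf[symmetric] using t by (intro sum.cong) (auto simp: abs_if)
  ultimately have "ln Q = real n * ln (real N) + (\<Sum>k<n. \<bar>ln (t k)\<bar>)" by simp
  moreover have "ln (real (?B n)) \<le> ln Q" using Q1 pos[of n] by simp
  moreover have "ln Q \<le> ln (2 * real (?B n))" using Q2 Qpos by (intro ln_mono) auto
  then have "ln Q \<le> ln 2 + ln (real (?B n))" using pos[of n] by (simp add: ln_mult)
  ultimately show ?thesis by (simp add: t_def)
qed

section \<open>The integral of the logarithm\<close>

text \<open>
  Integration by parts: the product of \<open>ln x\<close> and \<open>ln (1 + x / N)\<close> vanishes at both ends of the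
  unit interval, which trades \<open>- ln x / (N + x)\<close> for \<open>ln (1 + x / N) / x\<close>, a rescaling of the
  integrand of \<open>\<Theta>\<close>.
\<close>

lemma ln_kernel_has_integral:
  assumes "N > 0"
  shows "((\<lambda>x. \<bar>ln x\<bar> / (real N + x)) has_integral ncf_Theta (1 / real N)) {0..1}"
proof -
  have N: "real N \<ge> 1" using assms by simp
  let ?L = "\<lambda>x. ln (x / real N + 1) / x"
  \<comment> \<open>The integrand of \<open>\<Theta>\<close> with its removable singularity at \<open>0\<close> filled in.\<close>
  define h where "h x = (if x = 0 then 1 else ln (x + 1) / x)" for x :: real
  have "continuous_on {0..1 / real N} h"
    unfolding continuous_on_eq_continuous_within
  proof
    fix x assume x: "x \<in> {0..1 / real N}"
    show "continuous (at x within {0..1 / real N}) h"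
    proof (cases "x = 0")
      case True
      have "((\<lambda>x::real. ln (x + 1) / x) \<longlongrightarrow> 1) (at 0)" by real_asymp
      then have "(h \<longlongrightarrow> 1) (at 0)"
        by (rule Lim_transform_eventually) (auto simp: h_def eventually_at_filter)
      then have "isCont h 0" by (simp add: isCont_def h_def)
      then show ?thesis using True continuous_at_imp_continuous_at_within by blast
    next
      case False
      have "isCont (\<lambda>x. ln (x + 1) / x) x"
        using x False by (intro continuous_intros) auto
      moreover have "\<forall>\<^sub>F y in nhds x. h y = ln (y + 1) / y"
        using t1_space_nhds[OF False] by eventually_elim (simp add: h_def)
      ultimately have "isCont h x" using isCont_cong[of h "\<lambda>x. ln (x + 1) / x" x] by simp
      then show ?thesis by (rule continuous_at_imp_continuous_at_within)
    qed
  qed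
  then have "h integrable_on {0..1 / real N}"
    by (rule integrable_continuous_interval)
  then have "(\<lambda>x. ln (x + 1) / x) integrable_on {0..1 / real N}"
    by (rule integrable_spike_finite[of "{0}", rotated 2]) (auto simp: h_def)
  then have "((\<lambda>t. ln (t + 1) / t) has_integral ncf_Theta (1 / real N)) {0..1 / real N}"
    unfolding ncf_Theta_def by (rule integrable_integral)
  from has_integral_stretch_real[OF this, of "1 / real N"]
  have "((\<lambda>x. real N * ?L x) has_integral real N * ncf_Theta (1 / real N)) ((\<lambda>x. x * real N) ` {0..1 / real N})"
    using N by (simp add: mult.commute)
  also have "(\<lambda>x. x * real N) ` {0..1 / real N} = {0..1}"
    using N by (subst image_mult_atLeastAtMost_if') simp
  finally have "((\<lambda>x. real N * ?L x) has_integral real N * ncf_Theta (1 / real N)) {0..1}" .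
  from has_integral_divide[OF this, of "real N"] N
  have L: "(?L has_integral ncf_Theta (1 / real N)) {0..1}"
    by simp
  let ?G = "\<lambda>x. ln x * ln (x / real N + 1)"
  \<comment> \<open>At \<open>0\<close> the value is \<open>0\<close> because \<open>ln 0 = 0\<close>, which agrees with the limit from the right.\<close>
  have contG: "continuous_on {0..1} ?G"
    unfolding continuous_on_eq_continuous_within
  proof
    fix x :: real assume x: "x \<in> {0..1}"
    show "continuous (at x within {0..1}) ?G"
    proof (cases "x = 0")
      case True
      have "(?G \<longlongrightarrow> 0) (at_right 0)" using N by real_asymp
      then have "(?G \<longlongrightarrow> 0) (at 0 within {0..1})"
        by (simp add: at_within_Icc_at_right)
      then show ?thesis using True by (simp add: continuous_within)
    next
      case False
      then show ?thesis using x N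
        by (intro continuous_intros) (auto simp: add_nonneg_eq_0_iff)
    qed
  qed
  have "((\<lambda>x. ?L x + ln x / (real N + x)) has_integral (?G 1 - ?G 0)) {0..1}"
  proof (rule fundamental_theorem_of_calculus_interior[OF _ contG])
    fix x :: real assume x: "x \<in> {0<..<1}"
    have "x / real N + 1 > 0" "(x / real N + 1) * real N = real N + x"
      using x assms by (auto simp: add_pos_pos distrib_right)
    then have "(?G has_real_derivative ?L x + ln x / (real N + x)) (at x)"
      using x assms by (auto intro!: derivative_eq_intros)
    then show "(?G has_vector_derivative ?L x + ln x / (real N + x)) (at x)"
      by (simp add: has_real_derivative_iff_has_vector_derivative)
  qed simp
  from has_integral_diff[OF L this]
  have I: "((\<lambda>x. - (ln x / (real N + x))) has_integral ncf_Theta (1 / real N)) {0..1}"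
    by simp
  have "ln x \<le> 0" if "x \<in> {0..1}" for x :: real
    using that by (cases "x = 0") auto
  then show ?thesis
    by (intro has_integral_eq[OF _ I]) simp
qed

lemma inverse_shift_has_integral:
  assumes "N > 0"
  shows "((\<lambda>x. 1 / (real N + x)) has_integral ln (1 + 1 / real N)) {0..1}"
proof -
  have "((\<lambda>x. 1 / (real N + x)) has_integral (ln (real N + 1) - ln (real N + 0))) {0..1}"
    using assms
    by (intro fundamental_theorem_of_calculus)
       (auto intro!: derivative_eq_intros simp flip: has_real_derivative_iff_has_vector_derivative)
  also have "ln (real N + 1) - ln (real N + 0) = ln (1 + 1 / real N)"
    using assms by (subst ln_divide_pos[symmetric]) (auto simp: add_divide_distrib add.commute)
  finally show ?thesis .
qed

section \<open>The transfer operator\<close>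

definition ncf_branch :: "nat \<Rightarrow> nat \<Rightarrow> real \<Rightarrow> real" where
  "ncf_branch N i x = real N / (real N + real i + x)"

text \<open>
  The probability of the \<open>i\<close>-th preimage of \<open>x\<close> under the Gauss measure: with
  \<open>u = N / (N + i + x)\<close> it is \<open>\<bar>du/dx\<bar> (N + x) / (N + u)\<close>, the invariant density being
  proportional to \<open>1 / (N + x)\<close>.
\<close>

definition ncf_weight :: "nat \<Rightarrow> nat \<Rightarrow> real \<Rightarrow> real" where
  "ncf_weight N i x = (real N + x) / ((real N + real i + x) * (real N + real i + 1 + x))"

definition ncf_transfer :: "nat \<Rightarrow> (real \<Rightarrow> real) \<Rightarrow> real \<Rightarrow> real" where
  "ncf_transfer N g x = (\<Sum>i. ncf_weight N i x * g (ncf_branch N i x))"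

text \<open>
  Since the weights decay like \<open>1 / i\<^sup>2\<close> and the branches like \<open>1 / i\<close>, this growth at \<open>0\<close> is mild
  enough for the series of the transfer operator to converge, and it still admits powers of the
  logarithm.
\<close>

definition sqrt_growth :: "(real \<Rightarrow> real) \<Rightarrow> bool" where
  "sqrt_growth g \<longleftrightarrow> (\<exists>C. \<forall>u\<in>{0<..1}. \<bar>g u\<bar> \<le> C / sqrt u)"

text \<open>
  For a monotone function the oscillation is read off at the end points. Both directions are
  included because the transfer operator reverses monotonicity.
\<close>

definition osc_bound :: "(real \<Rightarrow> real) \<Rightarrow> real \<Rightarrow> bool" where
  "osc_bound g D \<longleftrightarrow> (mono_on {0..1} g \<or> antimono_on {0..1} g) \<and> \<bar>g 1 - g 0\<bar> \<le> D"

definition ncf_gauss_measure :: "nat \<Rightarrow> real measure" where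
  "ncf_gauss_measure N = density lborel
     (\<lambda>x. ennreal (indicator {0<..<1} x / ((real N + x) * ln (1 + 1 / real N))))"

text \<open>
  A class of functions that is invariant under the transfer operator and contains \<open>\<bar>ln\<bar>\<close> and its
  square.
\<close>

definition tame :: "(real \<Rightarrow> real) \<Rightarrow> bool" where
  "tame g \<longleftrightarrow> g \<in> borel_measurable borel \<and> (\<forall>u\<in>{0<..1}. 0 \<le> g u) \<and> sqrt_growth g \<and>
     (mono_on {0<..1} g \<or> antimono_on {0<..1} g)"

context
  fixes N :: nat
  assumes N_pos: "N > 0"
begin

lemma ncf_branch_range:
  assumes "0 \<le> x"
  shows "ncf_branch N i x \<in> {0<..1}"
  using assms N_pos by (simp add: ncf_branch_def)

lemma ncf_branch_antimono:
  assumes "0 \<le> x" "x \<le> y"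
  shows "ncf_branch N i y \<le> ncf_branch N i x"
  using assms N_pos unfolding ncf_branch_def by (intro divide_left_mono) auto

lemma ncf_branch_index_antimono:
  assumes "0 \<le> x"
  shows "ncf_branch N (Suc i) x \<le> ncf_branch N i x"
  using assms N_pos unfolding ncf_branch_def by (intro divide_left_mono) auto

lemma ncf_weight_pos:
  assumes "0 \<le> x"
  shows "0 < ncf_weight N i x"
  using assms N_pos unfolding ncf_weight_def by (intro divide_pos_pos mult_pos_pos) auto

text \<open>
  The weights telescope: the \<open>i\<close>-th one is
  \<open>(N + x) / (N + i + x) - (N + x) / (N + i + 1 + x)\<close>. The closed form shows that the partial sums
  decrease in \<open>x\<close>, that is, the preimages move towards \<open>0\<close> in distribution as \<open>x\<close> grows.
\<close>

lemma sum_ncf_weight: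
  assumes "0 \<le> x"
  shows "(\<Sum>i<n. ncf_weight N i x) = real n / (real N + real n + x)"
proof (induction n)
  case (Suc n)
  define c where "c = real N + real n + x"
  have c: "0 < c" using N_pos assms by (simp add: c_def)
  have "(\<Sum>i<Suc n. ncf_weight N i x) = real n / c + (c - real n) / (c * (c + 1))"
    using Suc by (simp add: ncf_weight_def c_def add_ac)
  also have "\<dots> = real (Suc n) / (c + 1)"
  proof -
    have "real n / c = real n * (c + 1) / (c * (c + 1))" using c by simp
    then have "real n / c + (c - real n) / (c * (c + 1)) = (c * real (Suc n)) / (c * (c + 1))"
      by (simp add: add_divide_distrib[symmetric] algebra_simps)
    then show ?thesis using c by simp
  qed
  finally show ?case by (simp add: c_def add_ac)
qed simp

lemma ncf_weight_sums_1:
  assumes "0 \<le> x"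
  shows "(\<lambda>i. ncf_weight N i x) sums 1"
  unfolding sums_def sum_ncf_weight[OF assms] by real_asymp

lemma sqrt_growth_branch:
  assumes "sqrt_growth g"
  obtains C where "C \<ge> 0" "\<And>i x. x \<in> {0..1} \<Longrightarrow> \<bar>g (ncf_branch N i x)\<bar> \<le> C * sqrt (real N + real i + 1)"
proof -
  obtain C where C: "\<And>u. u \<in> {0<..1} \<Longrightarrow> \<bar>g u\<bar> \<le> C / sqrt u"
    using assms unfolding sqrt_growth_def by blast
  have "0 \<le> C" using C[of 1] by simp
  moreover have "\<bar>g (ncf_branch N i x)\<bar> \<le> C * sqrt (real N + real i + 1)" if x: "x \<in> {0..1}" for i x
  proof -
    have u: "ncf_branch N i x \<in> {0<..1}" using ncf_branch_range x by simp
    have "1 / ncf_branch N i x = (real N + real i + x) / real N"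
      by (simp add: ncf_branch_def)
    also have "\<dots> \<le> (real N + real i + 1) / 1"
      using N_pos x by (intro frac_le) auto
    finally have "sqrt (1 / ncf_branch N i x) \<le> sqrt (real N + real i + 1)"
      by simp
    then have "C * sqrt (1 / ncf_branch N i x) \<le> C * sqrt (real N + real i + 1)"
      using \<open>0 \<le> C\<close> by (rule mult_left_mono)
    then show ?thesis using C[OF u] by (simp add: real_sqrt_divide)
  qed
  ultimately show thesis by (rule that)
qed

lemma summable_ncf_weight_mult:
  assumes g: "sqrt_growth g" and x: "x \<in> {0..1}" and y: "y \<in> {0..1}"
  shows "summable (\<lambda>i. ncf_weight N i x * g (ncf_branch N i y))"
proof -
  obtain C where C: "C \<ge> 0" "\<And>i x. x \<in> {0..1} \<Longrightarrow> \<bar>g (ncf_branch N i x)\<bar> \<le> C * sqrt (real N + real i + 1)"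
    using sqrt_growth_branch[OF g] by blast
  have "summable (\<lambda>i. norm (real i powr (-3/2)))"
    by (simp add: summable_real_powr_iff)
  then have s: "summable (\<lambda>i. ncf_weight N i x * (C * sqrt (real N + real i + 1)))"
  proof (rule summable_comparison_test_bigo)
    show "(\<lambda>i. ncf_weight N i x * (C * sqrt (real N + real i + 1))) \<in> O(\<lambda>i. real i powr (-3/2))"
      unfolding ncf_weight_def by real_asymp
  qed
  show ?thesis
    by (rule summable_comparison_test'[OF s, of 0])
       (use C(2)[OF y] ncf_weight_pos[of x] x in \<open>auto simp: abs_mult less_imp_le intro!: mult_left_mono\<close>)
qed

text \<open>
  Summation by parts in the form of an inequality: signed masses with nonnegative partial sums
  charge the early, larger values most.
\<close>

lemma sum_ncf_weight_decreasing_values: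
  fixes d g :: "nat \<Rightarrow> real"
  assumes "\<And>i. g (Suc i) \<le> g i" "\<And>n. 0 \<le> (\<Sum>i<n. d i)"
  shows "g n * (\<Sum>i<n. d i) \<le> (\<Sum>i<n. d i * g i)"
proof (induction n)
  case (Suc n)
  have "g (Suc n) * (\<Sum>i<Suc n. d i) \<le> g n * (\<Sum>i<Suc n. d i)"
    by (intro mult_right_mono assms)
  also have "\<dots> \<le> (\<Sum>i<Suc n. d i * g i)"
    using Suc by (simp add: algebra_simps)
  finally show ?case .
qed simp

text \<open>
  Two effects act in the same direction when \<open>x\<close> increases: every branch moves to the left, and
  mass shifts to branches of larger index, which lie further to the left. The boundary term of the
  summation by parts is at most of order \<open>sqrt n / n\<close>.
\<close>

lemma ncf_transfer_mono:
  assumes mono: "mono_on {0<..1} g" and g: "sqrt_growth g"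
  shows "antimono_on {0..1} (ncf_transfer N g)"
proof (rule monotone_onI)
  fix x y :: real
  assume x: "x \<in> {0..1}" and y: "y \<in> {0..1}" and xy: "x \<le> y"
  have x0: "0 \<le> x" and y0: "0 \<le> y" using x y by auto
  let ?v = "\<lambda>i. g (ncf_branch N i x)"
  let ?d = "\<lambda>i. ncf_weight N i x - ncf_weight N i y"
  obtain C where C: "C \<ge> 0" "\<And>i x. x \<in> {0..1} \<Longrightarrow> \<bar>g (ncf_branch N i x)\<bar> \<le> C * sqrt (real N + real i + 1)"
    using sqrt_growth_branch[OF g] by blast
  have d_sum: "(\<Sum>i<n. ?d i) = real n / (real N + real n + x) - real n / (real N + real n + y)" for n
    using x0 y0 by (simp add: sum_subtractf sum_ncf_weight)
  have d_nonneg: "0 \<le> (\<Sum>i<n. ?d i)" for n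
    unfolding d_sum using x0 xy N_pos by (simp add: divide_left_mono)
  have d_le: "(\<Sum>i<n. ?d i) \<le> 1 / (real N + real n)" for n
  proof -
    have "(\<Sum>i<n. ?d i) = real n * (y - x) / ((real N + real n + x) * (real N + real n + y))"
      unfolding d_sum using x0 y0 N_pos
      by (subst diff_frac_eq) (auto simp: algebra_simps add_eq_0_iff)
    also have "\<dots> \<le> ((real N + real n) * 1) / ((real N + real n) * (real N + real n))"
      using x y xy N_pos by (intro frac_le mult_mono) auto
    also have "\<dots> = 1 / (real N + real n)" using N_pos by simp
    finally show ?thesis .
  qed
  have lim0: "(\<lambda>n. ?v n * (\<Sum>i<n. ?d i)) \<longlonglongrightarrow> 0"
  proof (rule Lim_null_comparison)
    show "\<forall>\<^sub>F n in sequentially. norm (?v n * (\<Sum>i<n. ?d i)) \<le> C * sqrt (real N + real n + 1) * (1 / (real N + real n))"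
    proof (intro always_eventually allI)
      fix n
      have "norm (?v n * (\<Sum>i<n. ?d i)) = \<bar>?v n\<bar> * (\<Sum>i<n. ?d i)"
        using d_nonneg by (simp add: abs_mult)
      also have "\<dots> \<le> C * sqrt (real N + real n + 1) * (1 / (real N + real n))"
        using C(1) by (intro mult_mono C(2) x d_le d_nonneg) auto
      finally show "norm (?v n * (\<Sum>i<n. ?d i)) \<le> C * sqrt (real N + real n + 1) * (1 / (real N + real n))" .
    qed
    show "(\<lambda>n. C * sqrt (real N + real n + 1) * (1 / (real N + real n))) \<longlonglongrightarrow> 0"
      by real_asymp
  qed
  have dv: "(\<lambda>i. ?d i * ?v i) sums
      ((\<Sum>i. ncf_weight N i x * ?v i) - (\<Sum>i. ncf_weight N i y * ?v i))"
    unfolding left_diff_distrib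
    by (intro sums_diff summable_sums summable_ncf_weight_mult g x y)
  have "0 \<le> (\<Sum>i. ncf_weight N i x * ?v i) - (\<Sum>i. ncf_weight N i y * ?v i)"
  proof (rule LIMSEQ_le[OF lim0 dv[unfolded sums_def]], intro exI allI impI)
    fix n
    show "?v n * (\<Sum>i<n. ?d i) \<le> (\<Sum>i<n. ?d i * ?v i)"
      using x0 by (intro sum_ncf_weight_decreasing_values d_nonneg mono_onD[OF mono]
          ncf_branch_range ncf_branch_index_antimono)
  qed
  moreover have "(\<Sum>i. ncf_weight N i y * g (ncf_branch N i y)) \<le> (\<Sum>i. ncf_weight N i y * ?v i)"
    using x0 y0 xy
    by (intro suminf_le mult_left_mono mono_onD[OF mono] ncf_branch_range ncf_branch_antimono
        summable_ncf_weight_mult g x y less_imp_le[OF ncf_weight_pos])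
  ultimately show "ncf_transfer N g x \<ge> ncf_transfer N g y"
    by (simp add: ncf_transfer_def)
qed

lemma ncf_transfer_minus: "ncf_transfer N (\<lambda>u. - g u) x = - ncf_transfer N g x"
  if "sqrt_growth g" "x \<in> {0..1}"
  using summable_ncf_weight_mult[OF that(1) that(2) that(2)]
  by (simp add: ncf_transfer_def suminf_minus)

lemma ncf_transfer_antimono:
  assumes "antimono_on {0<..1} g" and g: "sqrt_growth g"
  shows "mono_on {0..1} (ncf_transfer N g)"
proof -
  have "mono_on {0<..1} (\<lambda>u. - g u)"
    using assms(1) by (auto simp: monotone_on_def)
  moreover have "sqrt_growth (\<lambda>u. - g u)" using g by (simp add: sqrt_growth_def)
  ultimately have "antimono_on {0..1} (ncf_transfer N (\<lambda>u. - g u))"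
    by (rule ncf_transfer_mono)
  then show ?thesis by (auto simp: monotone_on_def ncf_transfer_minus[OF g])
qed

lemma sqrt_growth_monotone_on_Icc:
  assumes "mono_on {0..1} g \<or> antimono_on {0..1} g"
  shows "sqrt_growth g"
  unfolding sqrt_growth_def
proof (intro exI ballI)
  fix u :: real
  assume u: "u \<in> {0<..1}"
  have "\<bar>g u\<bar> \<le> \<bar>g 0\<bar> + \<bar>g 1\<bar>"
    using assms
  proof
    assume "mono_on {0..1} g"
    from monotone_onD[OF this, of 0 u] monotone_onD[OF this, of u 1] u show ?thesis by auto
  next
    assume "antimono_on {0..1} g"
    from monotone_onD[OF this, of 0 u] monotone_onD[OF this, of u 1] u show ?thesis by auto
  qed
  also have "\<dots> \<le> (\<bar>g 0\<bar> + \<bar>g 1\<bar>) / sqrt u"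
    using u by (simp add: pos_le_divide_eq mult_left_le)
  finally show "\<bar>g u\<bar> \<le> (\<bar>g 0\<bar> + \<bar>g 1\<bar>) / sqrt u" .
qed

text \<open>
  Every point \<open>N / (N + i + 1)\<close> is both the branch \<open>i + 1\<close> at \<open>0\<close> and the branch \<open>i\<close> at \<open>1\<close>, with
  nearly the same weight. After cancellation only the mass \<open>1 / (N + 1)\<close>, which sits on the branch
  \<open>0\<close> at \<open>0\<close>, is transported, and transporting it costs at most the oscillation of \<open>g\<close>.
\<close>

lemma ncf_transfer_endpoint_contraction:
  assumes g: "mono_on {0..1} g"
  shows "ncf_transfer N g 0 - ncf_transfer N g 1 \<le> (g 1 - g 0) / (real N + 1)"
proof -
  have gr: "sqrt_growth g" using g by (simp add: sqrt_growth_monotone_on_Icc)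
  let ?v = "\<lambda>i. g (ncf_branch N i 1)"
  let ?r = "\<lambda>i. ncf_weight N i 1 / (real N + 1)"
  have v0: "ncf_branch N (Suc i) 0 = ncf_branch N i 1" for i
    by (simp add: ncf_branch_def add_ac)
  have w0: "ncf_weight N (Suc i) 0 = ncf_weight N i 1 - ?r i" for i
  proof -
    define c where "c = real N + real i + 1"
    have "ncf_weight N (Suc i) 0 = real N / (c * (c + 1))" "ncf_weight N i 1 = (real N + 1) / (c * (c + 1))"
      by (simp_all add: ncf_weight_def c_def add_ac)
    then show ?thesis by (simp add: diff_divide_distrib[symmetric])
  qed
  have h0: "ncf_weight N 0 0 * g (ncf_branch N 0 0) = g 1 / (real N + 1)"
    using N_pos by (simp add: ncf_weight_def ncf_branch_def)
  have s1: "summable (\<lambda>i. ncf_weight N i 1 * ?v i)"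
    using gr by (intro summable_ncf_weight_mult) auto
  have r_sum: "?r sums (1 / (real N + 1))"
    by (intro sums_divide ncf_weight_sums_1) simp
  have rv: "summable (\<lambda>i. ?r i * ?v i)"
    using summable_divide[OF s1, of "real N + 1"] by simp
  have "ncf_transfer N g 0 = g 1 / (real N + 1) + (\<Sum>i. ncf_weight N (Suc i) 0 * ?v i)"
    unfolding ncf_transfer_def h0[symmetric] v0[symmetric]
    using summable_ncf_weight_mult[OF gr, of 0 0] by (subst suminf_split_head) auto
  also have "(\<Sum>i. ncf_weight N (Suc i) 0 * ?v i) = ncf_transfer N g 1 - (\<Sum>i. ?r i * ?v i)"
    unfolding w0 left_diff_distrib ncf_transfer_def
    using s1 rv by (rule suminf_diff[symmetric])
  finally have eq: "ncf_transfer N g 0 - ncf_transfer N g 1 = g 1 / (real N + 1) - (\<Sum>i. ?r i * ?v i)"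
    by simp
  have "g 0 / (real N + 1) = (\<Sum>i. ?r i * g 0)"
    using sums_mult2[OF r_sum, of "g 0"] by (simp add: sums_iff)
  also have "\<dots> \<le> (\<Sum>i. ?r i * ?v i)"
    using sums_summable[OF sums_mult2[OF r_sum]] rv ncf_weight_pos[of 1] ncf_branch_range[of 1]
    by (intro suminf_le mult_left_mono monotone_onD[OF g]) (auto simp: less_imp_le)
  finally show ?thesis unfolding eq by (simp add: diff_divide_distrib)
qed

text \<open>
  For a monotone function the difference of the end point values is the whole oscillation, so the
  end point estimate is a contraction by the factor \<open>1 / (N + 1)\<close> and can be iterated.
\<close>

lemma osc_bound_transfer:
  assumes "osc_bound g D"
  shows "osc_bound (ncf_transfer N g) (D / (real N + 1))"
proof -
  have *: "antimono_on {0..1} (ncf_transfer N h) \<and> \<bar>ncf_transfer N h 1 - ncf_transfer N h 0\<bar> \<le> D / (real N + 1)"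
    if h: "mono_on {0..1} h" "\<bar>h 1 - h 0\<bar> \<le> D" for h
  proof -
    have anti: "antimono_on {0..1} (ncf_transfer N h)"
      using h(1) by (intro ncf_transfer_mono sqrt_growth_monotone_on_Icc) (auto elim: mono_on_subset)
    have "ncf_transfer N h 1 \<le> ncf_transfer N h 0"
      using monotone_onD[OF anti, of 0 1] by simp
    moreover have "(h 1 - h 0) / (real N + 1) \<le> D / (real N + 1)"
      using h(2) by (intro divide_right_mono) auto
    ultimately show ?thesis
      using ncf_transfer_endpoint_contraction[OF h(1)] anti by simp
  qed
  from assms consider "mono_on {0..1} g" | "antimono_on {0..1} g"
    by (auto simp: osc_bound_def)
  then show ?thesis
  proof cases
    case 1
    then show ?thesis using *[OF 1] assms by (auto simp: osc_bound_def)
  next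
    case 2
    then have gr: "sqrt_growth g" by (simp add: sqrt_growth_monotone_on_Icc)
    have "mono_on {0..1} (\<lambda>u. - g u)" using 2 by (auto simp: monotone_on_def)
    from *[OF this] assms show ?thesis
      by (auto simp: osc_bound_def monotone_on_def ncf_transfer_minus[OF gr] abs_minus_commute)
  qed
qed

lemma osc_bound_le:
  assumes "osc_bound g D" "x \<in> {0..1}" "y \<in> {0..1}"
  shows "g x \<le> g y + D"
proof -
  have "mono_on {0..1} g \<or> antimono_on {0..1} g" and D: "\<bar>g 1 - g 0\<bar> \<le> D"
    using assms(1) by (auto simp: osc_bound_def)
  then show ?thesis
  proof (elim disjE)
    assume "mono_on {0..1} g"
    from monotone_onD[OF this, of 0 y] monotone_onD[OF this, of x 1] assms(2,3) D show ?thesis by auto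
  next
    assume "antimono_on {0..1} g"
    from monotone_onD[OF this, of 0 x] monotone_onD[OF this, of y 1] assms(2,3) D show ?thesis by auto
  qed
qed

lemma ncf_transfer_nonneg:
  assumes "\<And>u. u \<in> {0<..1} \<Longrightarrow> 0 \<le> g u" "sqrt_growth g" "x \<in> {0..1}"
  shows "0 \<le> ncf_transfer N g x"
  unfolding ncf_transfer_def
  using assms ncf_branch_range[of x] ncf_weight_pos[of x]
  by (intro suminf_nonneg summable_ncf_weight_mult mult_nonneg_nonneg) (auto simp: less_imp_le)

lemma sqrt_growth_ln: "sqrt_growth (\<lambda>u. \<bar>ln u\<bar>)"
  and sqrt_growth_ln_sq: "sqrt_growth (\<lambda>u. \<bar>ln u\<bar> * \<bar>ln u\<bar>)"
proof -
  have w: "\<bar>ln u\<bar> * \<bar>ln u\<bar> \<le> 16 / sqrt u \<and> \<bar>ln u\<bar> \<le> 4 / sqrt u" if u: "u \<in> {0<..1}" for u :: real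
  proof -
    \<comment> \<open>The fourth root lets the bound \<open>ln y \<le> y - 1\<close> survive squaring.\<close>
    define w where "w = sqrt (sqrt u)"
    have w: "0 < w" "w \<le> 1" "sqrt u = w * w" using u by (auto simp: w_def)
    have "\<bar>ln u\<bar> = 4 * ln (1 / w)"
      using u by (simp add: w_def ln_div ln_sqrt)
    also have "\<dots> \<le> 4 * (1 / w)"
      using ln_le_minus_one[of "1 / w"] w by simp
    finally have *: "\<bar>ln u\<bar> \<le> 4 / w" by simp
    then have "\<bar>ln u\<bar> * \<bar>ln u\<bar> \<le> (4 / w) * (4 / w)"
      using w by (intro mult_mono) auto
    moreover have "4 / w \<le> 4 / (w * w)"
      using w by (intro divide_left_mono) (auto simp: mult_left_le)
    ultimately show ?thesis using * w by auto
  qed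
  show "sqrt_growth (\<lambda>u. \<bar>ln u\<bar>)"
    unfolding sqrt_growth_def
  proof (intro exI ballI)
    fix u :: real assume "u \<in> {0<..1}"
    from w[OF this] show "\<bar>\<bar>ln u\<bar>\<bar> \<le> 4 / sqrt u" by simp
  qed
  show "sqrt_growth (\<lambda>u. \<bar>ln u\<bar> * \<bar>ln u\<bar>)"
    unfolding sqrt_growth_def
  proof (intro exI ballI)
    fix u :: real assume "u \<in> {0<..1}"
    from w[OF this] show "\<bar>\<bar>ln u\<bar> * \<bar>ln u\<bar>\<bar> \<le> 16 / sqrt u" by simp
  qed
qed

section \<open>The Gauss measure\<close>

lemma borel_measurable_ncf_map [measurable]: "ncf_map N \<in> borel_measurable borel"
  unfolding ncf_map_def[abs_def] frac_def by measurable

lemma borel_measurable_funpow_ncf_map [measurable]: "ncf_map N ^^ k \<in> borel_measurable borel"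
  by (induction k) (auto simp: o_def id_def intro: measurable_compose[OF _ borel_measurable_ncf_map])

lemma borel_measurable_ncf_branch [measurable]: "ncf_branch N i \<in> borel_measurable borel"
  unfolding ncf_branch_def[abs_def] by measurable

lemma borel_measurable_ncf_weight [measurable]: "ncf_weight N i \<in> borel_measurable borel"
  unfolding ncf_weight_def[abs_def] by measurable

lemma borel_measurable_ncf_transfer [measurable]:
  assumes [measurable]: "g \<in> borel_measurable borel"
  shows "ncf_transfer N g \<in> borel_measurable borel"
  unfolding ncf_transfer_def[abs_def] by measurable

lemma ncf_map_branch:
  assumes "0 \<le> t" "t < 1"
  shows "ncf_map N (ncf_branch N i t) = t"
proof -
  have "real N / ncf_branch N i t = of_int (int (N + i)) + t"
    using N_pos assms by (simp add: ncf_branch_def)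
  moreover have "ncf_branch N i t \<noteq> 0" using ncf_branch_range[of t i] assms by auto
  moreover have "frac (of_int (int (N + i)) + t) = t"
    using assms by (subst frac_unique_iff) auto
  ultimately show ?thesis by (simp add: ncf_map_def)
qed

text \<open>
  The branches decrease, so the substitution runs through \<open>t = 1 - s\<close>.
\<close>

lemma nn_integral_one_branch:
  fixes H :: "real \<Rightarrow> ennreal"
  assumes [measurable]: "H \<in> borel_measurable borel"
  shows "(\<integral>\<^sup>+x. H x * indicator {ncf_branch N i 1..ncf_branch N i 0} x \<partial>lborel)
    = (\<integral>\<^sup>+t. H (ncf_branch N i t) * ennreal (real N / (real N + real i + t)\<^sup>2) * indicator {0..1} t \<partial>lborel)"
proof -
  let ?g' = "\<lambda>s. real N / (real N + real i + (1 - s))\<^sup>2"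
  let ?g = "\<lambda>s. ncf_branch N i (1 - s)"
  have "(\<integral>\<^sup>+x. H x * indicator {?g 0..?g 1} x \<partial>lborel)
      = (\<integral>\<^sup>+s. H (?g s) * ?g' s * indicator {0..1} s \<partial>lborel)"
  proof (rule nn_integral_substitution_aux)
    fix s :: real assume s: "s \<in> {0..1}"
    have nz: "real N + real i + (1 - s) \<noteq> 0" using s N_pos by auto
    show "(?g has_real_derivative ?g' s) (at s)"
      unfolding ncf_branch_def using nz
      by (auto intro!: derivative_eq_intros simp: power2_eq_square)
  next
    show "continuous_on {0..1} ?g'"
      using N_pos by (intro continuous_intros) auto
  qed auto
  also have "\<dots> = ennreal \<bar>-1\<bar> * (\<integral>\<^sup>+t. H (?g (1 + (-1) * t)) * ?g' (1 + (-1) * t) * indicator {0..1} (1 + (-1) * t) \<partial>lborel)"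
    by (rule nn_integral_real_affine) auto
  also have "\<dots> = (\<integral>\<^sup>+t. H (ncf_branch N i t) * ennreal (real N / (real N + real i + t)\<^sup>2) * indicator {0..1} t \<partial>lborel)"
    by (auto intro!: nn_integral_cong simp: indicator_def)
  finally show ?thesis by simp
qed

text \<open>
  The images of the branches are the sets on which the first digit is constant; up to end points
  they partition the unit interval.
\<close>

lemma nn_integral_all_branches:
  fixes H :: "real \<Rightarrow> ennreal"
  assumes [measurable]: "H \<in> borel_measurable borel"
  shows "(\<integral>\<^sup>+x. H x * indicator {0<..<1} x \<partial>lborel)
    = (\<Sum>i. \<integral>\<^sup>+t. H (ncf_branch N i t) * ennreal (real N / (real N + real i + t)\<^sup>2) * indicator {0..1} t \<partial>lborel)"
proof -
  define A where "A i = {ncf_branch N i 1<..ncf_branch N i 0}" for i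
  have A_iff: "x \<in> A i \<longleftrightarrow> 0 < x \<and> \<lfloor>real N / x\<rfloor> = int (N + i)" for x i
  proof (cases "0 < x")
    case True
    then have "x \<in> A i \<longleftrightarrow> real N / x < real N + real i + 1 \<and> real N + real i \<le> real N / x"
      using N_pos by (auto simp: A_def ncf_branch_def field_simps)
    then show ?thesis using True by (auto simp: floor_eq_iff)
  next
    case False
    moreover have "0 < ncf_branch N i 1" using ncf_branch_range[of 1 i] by simp
    ultimately show ?thesis by (auto simp: A_def)
  qed
  have disj: "disjoint_family A"
    by (auto simp: disjoint_family_on_def A_iff)
  have "(\<Union>i. A i) = {0<..1}"
  proof (intro equalityI subsetI)
    fix x assume "x \<in> (\<Union>i. A i)"
    then obtain i where "x \<in> A i" by blast
    moreover have "ncf_branch N i 0 \<le> 1" "0 < ncf_branch N i 1"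
      using ncf_branch_range[of _ i] by auto
    ultimately show "x \<in> {0<..1}" by (auto simp: A_def)
  next
    fix x :: real assume x: "x \<in> {0<..1}"
    then have "real N \<le> real N / x" by (simp add: pos_le_divide_eq mult_left_le)
    then have "int N \<le> \<lfloor>real N / x\<rfloor>" by (simp add: le_floor_iff)
    then have "x \<in> A (nat (\<lfloor>real N / x\<rfloor> - int N))" using x by (simp add: A_iff)
    then show "x \<in> (\<Union>i. A i)" by blast
  qed
  then have ind: "(\<Sum>i. indicator (A i) x) = (indicator {0<..1} x :: ennreal)" for x
    using suminf_indicator[OF disj, of x] by simp
  have [measurable]: "A i \<in> sets borel" for i by (simp add: A_def)
  have "(\<integral>\<^sup>+x. H x * indicator {0<..<1} x \<partial>lborel) = (\<integral>\<^sup>+x. H x * indicator {0<..1} x \<partial>lborel)"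
    using AE_lborel_singleton[of 1] by (intro nn_integral_cong_AE) (auto simp: indicator_def elim!: eventually_mono)
  also have "\<dots> = (\<integral>\<^sup>+x. (\<Sum>i. H x * indicator (A i) x) \<partial>lborel)"
    by (simp add: ind)
  also have "\<dots> = (\<Sum>i. \<integral>\<^sup>+x. H x * indicator (A i) x \<partial>lborel)"
    by (intro nn_integral_suminf) measurable
  also have "\<dots> = (\<Sum>i. \<integral>\<^sup>+x. H x * indicator {ncf_branch N i 1..ncf_branch N i 0} x \<partial>lborel)"
  proof (intro suminf_cong nn_integral_cong_AE)
    fix i
    show "AE x in lborel. H x * indicator (A i) x = H x * indicator {ncf_branch N i 1..ncf_branch N i 0} x"
      using AE_lborel_singleton[of "ncf_branch N i 1"]
      by eventually_elim (auto simp: A_def indicator_def)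
  qed
  finally show ?thesis by (simp only: nn_integral_one_branch[OF assms])
qed

abbreviation "\<mu> \<equiv> ncf_gauss_measure N"

lemma sets_gauss [measurable_cong]: "sets \<mu> = sets borel"
  by (simp add: ncf_gauss_measure_def)

lemma nn_integral_gauss:
  assumes [measurable]: "F \<in> borel_measurable borel"
  shows "(\<integral>\<^sup>+x. F x \<partial>\<mu>)
    = (\<integral>\<^sup>+x. ennreal (1 / ((real N + x) * ln (1 + 1 / real N))) * F x * indicator {0<..<1} x \<partial>lborel)"
proof -
  have [measurable]: "(\<lambda>x. ennreal (indicator {0<..<1} x / ((real N + x) * ln (1 + 1 / real N)))) \<in> borel_measurable lborel"
    by measurable
  show ?thesis unfolding ncf_gauss_measure_def
    by (subst nn_integral_density) (auto intro!: nn_integral_cong simp: indicator_def)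
qed

lemma AE_gauss_iff:
  "(AE x in \<mu>. P x) \<longleftrightarrow> (AE x in lborel. x \<in> {0<..<1} \<longrightarrow> P x)"
proof -
  have "0 < ln (1 + 1 / real N)" using N_pos by (simp add: ln_gt_zero)
  then have *: "0 < ennreal (indicator {0<..<1} x / ((real N + x) * ln (1 + 1 / real N))) \<longleftrightarrow> x \<in> {0<..<1}" for x
    by (auto simp: indicator_def ennreal_zero_less_divide intro!: divide_pos_pos mult_pos_pos)
  show ?thesis unfolding ncf_gauss_measure_def
    by (subst AE_density) (auto simp only: *, measurable)
qed

lemma AE_gauss_Ioo: "AE x in \<mu>. x \<in> {0<..<1}"
  by (simp add: AE_gauss_iff)

lemma nn_integral_gauss_cong:
  "(\<And>x. x \<in> {0<..<1} \<Longrightarrow> F x = G x) \<Longrightarrow> (\<integral>\<^sup>+x. F x \<partial>\<mu>) = (\<integral>\<^sup>+x. G x \<partial>\<mu>)"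
  by (intro nn_integral_cong_AE eventually_mono[OF AE_gauss_Ioo])

lemma nn_integral_gauss_mono:
  "(\<And>x. x \<in> {0<..<1} \<Longrightarrow> F x \<le> G x) \<Longrightarrow> (\<integral>\<^sup>+x. F x \<partial>\<mu>) \<le> (\<integral>\<^sup>+x. G x \<partial>\<mu>)"
  by (intro nn_integral_mono_AE eventually_mono[OF AE_gauss_Ioo])

lemma nn_integral_gauss_has_integral:
  assumes [measurable]: "g \<in> borel_measurable borel"
    and nonneg: "\<And>x. x \<in> {0..1} \<Longrightarrow> 0 \<le> g x"
    and I: "((\<lambda>x. g x / (real N + x)) has_integral I) {0..1}"
  shows "(\<integral>\<^sup>+x. ennreal (g x) \<partial>\<mu>) = ennreal (I / ln (1 + 1 / real N))"
proof -
  let ?c = "ln (1 + 1 / real N)"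
  have c: "0 < ?c" using N_pos by (simp add: ln_gt_zero)
  have "(\<integral>\<^sup>+x. ennreal (g x) \<partial>\<mu>) = (\<integral>\<^sup>+x. ennreal (1 / ((real N + x) * ?c)) * ennreal (g x) * indicator {0<..<1} x \<partial>lborel)"
    by (rule nn_integral_gauss) measurable
  also have "\<dots> = (\<integral>\<^sup>+x. ennreal (indicator {0..1} x * (g x / (real N + x) / ?c)) \<partial>lborel)"
  proof (rule nn_integral_cong_AE)
    show "AE x in lborel. ennreal (1 / ((real N + x) * ?c)) * ennreal (g x) * indicator {0<..<1} x
        = ennreal (indicator {0..1} x * (g x / (real N + x) / ?c))"
      using AE_lborel_singleton[of 0] AE_lborel_singleton[of 1]
    proof eventually_elim
      case (elim x)
      show ?case
      proof (cases "x \<in> {0<..<1}")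
        case True
        then have "0 \<le> g x" using nonneg by simp
        then show ?thesis using True c by (simp add: ennreal_mult[symmetric])
      next
        case False
        then have "x \<notin> {0..1}" using elim by auto
        then show ?thesis using False by simp
      qed
    qed
  qed
  also have "\<dots> = ennreal (I / ?c)"
    using nonneg c has_integral_divide[OF I] by (intro nn_integral_has_integral_lebesgue) auto
  finally show ?thesis .
qed

lemma prob_space_gauss: "prob_space \<mu>"
proof
  have "0 < ln (1 + 1 / real N)" using N_pos by (simp add: ln_gt_zero)
  then have "(\<integral>\<^sup>+x. ennreal 1 \<partial>\<mu>) = 1"
    using inverse_shift_has_integral[OF N_pos]
    by (subst nn_integral_gauss_has_integral) auto
  then show "emeasure \<mu> (space \<mu>) = 1" by simp
qed

text \<open>
  The transfer operator is dual to composition with the map. Branch by branch this is a change of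
  variables, in which the weights come out as the Jacobian times the ratio of the densities.
\<close>

lemma nn_integral_gauss_transfer:
  fixes F G :: "real \<Rightarrow> ennreal"
  assumes [measurable]: "F \<in> borel_measurable borel" "G \<in> borel_measurable borel"
  shows "(\<integral>\<^sup>+x. F (ncf_map N x) * G x \<partial>\<mu>)
    = (\<integral>\<^sup>+x. F x * (\<Sum>i. ennreal (ncf_weight N i x) * G (ncf_branch N i x)) \<partial>\<mu>)"
proof -
  let ?c = "ln (1 + 1 / real N)"
  let ?h = "\<lambda>x. ennreal (1 / ((real N + x) * ?c))"
  let ?H = "\<lambda>x. ?h x * (F (ncf_map N x) * G x)"
  have c: "0 < ?c" using N_pos by (simp add: ln_gt_zero)
  have jac: "1 / ((real N + ncf_branch N i t) * ?c) * (real N / (real N + real i + t)\<^sup>2)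
      = 1 / ((real N + t) * ?c) * ncf_weight N i t" if t: "0 < t" for i t
  proof -
    define a where "a = real N + real i + t"
    have a: "0 < a" "0 < real N" "0 < real N + t" using N_pos t by (auto simp: a_def)
    have "ncf_branch N i t = real N / a" by (simp add: ncf_branch_def a_def)
    then have "real N + ncf_branch N i t = real N * (a + 1) / a"
      using a by (simp add: field_simps)
    then have "1 / ((real N + ncf_branch N i t) * ?c) * (real N / (real N + real i + t)\<^sup>2)
      = 1 / (real N * (a + 1) / a * ?c) * (real N / a\<^sup>2)" by (simp add: a_def)
    also have "\<dots> = 1 / (a * (a + 1) * ?c)"
      using a c by (simp add: power2_eq_square)
    also have "\<dots> = 1 / ((real N + t) * ?c) * ((real N + t) / (a * (a + 1)))"
      using a c by simp
    also have "(real N + t) / (a * (a + 1)) = ncf_weight N i t"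
      by (simp add: ncf_weight_def a_def add_ac)
    finally show ?thesis .
  qed
  have "(\<integral>\<^sup>+x. F (ncf_map N x) * G x \<partial>\<mu>) = (\<integral>\<^sup>+x. ?H x * indicator {0<..<1} x \<partial>lborel)"
    by (rule nn_integral_gauss) measurable
  also have "\<dots> = (\<Sum>i. \<integral>\<^sup>+t. ?H (ncf_branch N i t) * ennreal (real N / (real N + real i + t)\<^sup>2) * indicator {0..1} t \<partial>lborel)"
    by (rule nn_integral_all_branches) measurable
  also have "\<dots> = (\<Sum>i. \<integral>\<^sup>+t. ?h t * (F t * (ennreal (ncf_weight N i t) * G (ncf_branch N i t))) * indicator {0<..<1} t \<partial>lborel)"
  proof (intro suminf_cong nn_integral_cong_AE)
    fix i
    show "AE t in lborel. ?H (ncf_branch N i t) * ennreal (real N / (real N + real i + t)\<^sup>2) * indicator {0..1} t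
      = ?h t * (F t * (ennreal (ncf_weight N i t) * G (ncf_branch N i t))) * indicator {0<..<1} t"
      using AE_lborel_singleton[of 0] AE_lborel_singleton[of 1]
    proof eventually_elim
      case (elim t)
      show ?case
      proof (cases "t \<in> {0<..<1}")
        case True
        then have T: "ncf_map N (ncf_branch N i t) = t" by (intro ncf_map_branch) auto
        have u: "0 < ncf_branch N i t" using ncf_branch_range[of t i] True by auto
        have w: "0 < ncf_weight N i t" using ncf_weight_pos[of t i] True by auto
        have "?h (ncf_branch N i t) * ennreal (real N / (real N + real i + t)\<^sup>2) = ?h t * ennreal (ncf_weight N i t)"
          using True u w c jac[of t i] by (simp add: ennreal_mult[symmetric] less_imp_le)
        then show ?thesis using True T by (simp add: ac_simps)
      next
        case False
        then have "t \<notin> {0..1}" using elim by auto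
        then show ?thesis using False by simp
      qed
    qed
  qed
  also have "\<dots> = (\<integral>\<^sup>+t. (\<Sum>i. ?h t * (F t * (ennreal (ncf_weight N i t) * G (ncf_branch N i t))) * indicator {0<..<1} t) \<partial>lborel)"
    by (intro nn_integral_suminf[symmetric]) measurable
  also have "\<dots> = (\<integral>\<^sup>+t. ?h t * (F t * (\<Sum>i. ennreal (ncf_weight N i t) * G (ncf_branch N i t))) * indicator {0<..<1} t \<partial>lborel)"
    by simp
  also have "\<dots> = (\<integral>\<^sup>+x. F x * (\<Sum>i. ennreal (ncf_weight N i x) * G (ncf_branch N i x)) \<partial>\<mu>)"
    by (rule nn_integral_gauss[symmetric]) measurable
  finally show ?thesis .
qed

text \<open>
  Invariance of the measure is duality with the constant function \<open>1\<close>, which the transfer operator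
  fixes because the weights sum to \<open>1\<close>.
\<close>

lemma nn_integral_gauss_funpow:
  fixes F :: "real \<Rightarrow> ennreal"
  assumes [measurable]: "F \<in> borel_measurable borel"
  shows "(\<integral>\<^sup>+x. F ((ncf_map N ^^ k) x) \<partial>\<mu>) = (\<integral>\<^sup>+x. F x \<partial>\<mu>)"
proof -
  have inv: "(\<integral>\<^sup>+x. K (ncf_map N x) \<partial>\<mu>) = (\<integral>\<^sup>+x. K x \<partial>\<mu>)"
    if [measurable]: "K \<in> borel_measurable borel" for K :: "real \<Rightarrow> ennreal"
  proof -
    have "(\<integral>\<^sup>+x. K (ncf_map N x) * 1 \<partial>\<mu>) = (\<integral>\<^sup>+x. K x * (\<Sum>i. ennreal (ncf_weight N i x) * 1) \<partial>\<mu>)"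
      by (rule nn_integral_gauss_transfer) measurable
    also have "\<dots> = (\<integral>\<^sup>+x. K x * 1 \<partial>\<mu>)"
    proof (rule nn_integral_gauss_cong)
      fix x :: real assume "x \<in> {0<..<1}"
      then have x: "0 \<le> x" by simp
      have "(\<Sum>i. ennreal (ncf_weight N i x)) = ennreal (\<Sum>i. ncf_weight N i x)"
        using ncf_weight_sums_1[OF x] ncf_weight_pos[OF x]
        by (intro suminf_ennreal2) (auto simp: less_imp_le sums_iff)
      then show "K x * (\<Sum>i. ennreal (ncf_weight N i x) * 1) = K x * 1"
        using ncf_weight_sums_1[OF x] by (simp add: sums_iff)
    qed
    finally show ?thesis by simp
  qed
  show ?thesis
  proof (induction k)
    case (Suc k)
    have "(\<integral>\<^sup>+x. F ((ncf_map N ^^ Suc k) x) \<partial>\<mu>) = (\<integral>\<^sup>+x. F ((ncf_map N ^^ k) (ncf_map N x)) \<partial>\<mu>)"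
      by (simp add: funpow_swap1)
    also have "\<dots> = (\<integral>\<^sup>+x. F ((ncf_map N ^^ k) x) \<partial>\<mu>)"
      by (rule inv) measurable
    finally show ?case using Suc by simp
  qed simp
qed

section \<open>Decay of correlations\<close>

lemma tame_transfer:
  assumes "tame g"
  shows "tame (ncf_transfer N g)" "mono_on {0..1} (ncf_transfer N g) \<or> antimono_on {0..1} (ncf_transfer N g)"
proof -
  have g: "sqrt_growth g" "g \<in> borel_measurable borel" "\<And>u. u \<in> {0<..1} \<Longrightarrow> 0 \<le> g u"
    "mono_on {0<..1} g \<or> antimono_on {0<..1} g"
    using assms by (auto simp: tame_def)
  show m: "mono_on {0..1} (ncf_transfer N g) \<or> antimono_on {0..1} (ncf_transfer N g)"
    using g(4) ncf_transfer_mono ncf_transfer_antimono g(1) by blast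
  have "mono_on {0<..1} (ncf_transfer N g) \<or> antimono_on {0<..1} (ncf_transfer N g)"
    using m by (auto simp: monotone_on_def)
  then show "tame (ncf_transfer N g)"
    unfolding tame_def using g m
    by (auto intro: sqrt_growth_monotone_on_Icc ncf_transfer_nonneg)
qed

lemma nn_integral_gauss_funpow_transfer:
  fixes F :: "real \<Rightarrow> ennreal"
  assumes [measurable]: "F \<in> borel_measurable borel" and g: "tame g"
  shows "(\<integral>\<^sup>+x. F ((ncf_map N ^^ k) x) * ennreal (g x) \<partial>\<mu>) = (\<integral>\<^sup>+x. F x * ennreal ((ncf_transfer N ^^ k) g x) \<partial>\<mu>)"
  using g
proof (induction k arbitrary: g)
  case (Suc k)
  have g: "sqrt_growth g" and [measurable]: "g \<in> borel_measurable borel"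
    and nn: "\<And>u. u \<in> {0<..1} \<Longrightarrow> 0 \<le> g u"
    using Suc.prems by (auto simp: tame_def)
  have "(\<integral>\<^sup>+x. F ((ncf_map N ^^ Suc k) x) * ennreal (g x) \<partial>\<mu>)
      = (\<integral>\<^sup>+x. F ((ncf_map N ^^ k) (ncf_map N x)) * ennreal (g x) \<partial>\<mu>)"
    by (simp add: funpow_swap1)
  also have "\<dots> = (\<integral>\<^sup>+x. F ((ncf_map N ^^ k) x) * (\<Sum>i. ennreal (ncf_weight N i x) * ennreal (g (ncf_branch N i x))) \<partial>\<mu>)"
    by (rule nn_integral_gauss_transfer) measurable
  also have "\<dots> = (\<integral>\<^sup>+x. F ((ncf_map N ^^ k) x) * ennreal (ncf_transfer N g x) \<partial>\<mu>)"
  proof (rule nn_integral_gauss_cong)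
    fix x :: real assume x: "x \<in> {0<..<1}"
    have w: "0 \<le> ncf_weight N i x" "0 \<le> g (ncf_branch N i x)" for i
      using ncf_weight_pos[of x i] ncf_branch_range[of x i] nn x by auto
    have "(\<Sum>i. ennreal (ncf_weight N i x) * ennreal (g (ncf_branch N i x)))
        = (\<Sum>i. ennreal (ncf_weight N i x * g (ncf_branch N i x)))"
      using w by (simp add: ennreal_mult)
    also have "\<dots> = ennreal (ncf_transfer N g x)"
      unfolding ncf_transfer_def using w x summable_ncf_weight_mult[OF g]
      by (intro suminf_ennreal2) auto
    finally show "F ((ncf_map N ^^ k) x) * (\<Sum>i. ennreal (ncf_weight N i x) * ennreal (g (ncf_branch N i x)))
        = F ((ncf_map N ^^ k) x) * ennreal (ncf_transfer N g x)" by simp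
  qed
  also have "\<dots> = (\<integral>\<^sup>+x. F x * ennreal ((ncf_transfer N ^^ k) (ncf_transfer N g) x) \<partial>\<mu>)"
    by (rule Suc.IH[OF tame_transfer(1)[OF Suc.prems]])
  finally show ?case by (simp add: funpow_swap1)
qed simp

text \<open>
  Although \<open>g\<close> may be unbounded near \<open>0\<close>, it has the same integral as its image under the transfer
  operator, which is bounded.
\<close>

lemma nn_integral_gauss_finite:
  assumes g: "tame g"
  shows "(\<integral>\<^sup>+x. ennreal (g x) \<partial>\<mu>) < \<infinity>"
proof -
  let ?P = "ncf_transfer N g"
  interpret prob_space \<mu> by (rule prob_space_gauss)
  have "osc_bound ?P \<bar>?P 1 - ?P 0\<bar>"
    using tame_transfer(2)[OF g] by (simp add: osc_bound_def)
  note osc = osc_bound_le[OF this]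
  have "(\<integral>\<^sup>+x. 1 * ennreal (g x) \<partial>\<mu>) = (\<integral>\<^sup>+x. 1 * ennreal (?P x) \<partial>\<mu>)"
    using nn_integral_gauss_funpow_transfer[OF _ g, of "\<lambda>_. 1" 1] by simp
  also have "\<dots> \<le> (\<integral>\<^sup>+x. ennreal (?P 1 + \<bar>?P 1 - ?P 0\<bar>) \<partial>\<mu>)"
    using osc[of _ 1] by (intro nn_integral_gauss_mono) (auto intro!: ennreal_leI)
  also have "\<dots> < \<infinity>" by (simp add: emeasure_space_1)
  finally show ?thesis by simp
qed

text \<open>
  By duality the iterate moves onto \<open>g\<close>. The iterated transfer of \<open>g\<close> keeps the mean \<open>m\<close> while its
  oscillation shrinks geometrically, so it exceeds \<open>m\<close> by at most that oscillation.
\<close>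

lemma nn_integral_gauss_correlation:
  fixes F :: "real \<Rightarrow> ennreal"
  assumes [measurable]: "F \<in> borel_measurable borel" and g: "tame g"
    and m: "(\<integral>\<^sup>+x. ennreal (g x) \<partial>\<mu>) = ennreal m" "0 \<le> m"
  defines "D \<equiv> \<bar>ncf_transfer N g 1 - ncf_transfer N g 0\<bar>"
  shows "(\<integral>\<^sup>+x. F ((ncf_map N ^^ Suc k) x) * ennreal (g x) \<partial>\<mu>)
    \<le> (\<integral>\<^sup>+x. F x \<partial>\<mu>) * ennreal (m + D / (real N + 1) ^ k)"
proof -
  interpret prob_space \<mu> by (rule prob_space_gauss)
  let ?P = "(ncf_transfer N ^^ Suc k) g"
  have osc: "osc_bound ?P (D / (real N + 1) ^ k)"
  proof (induction k)
    case 0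
    show ?case using tame_transfer(2)[OF g] by (simp add: osc_bound_def D_def)
  next
    case (Suc k)
    from osc_bound_transfer[OF this] show ?case by (simp add: mult.commute)
  qed
  have mean: "(\<integral>\<^sup>+x. ennreal (?P x) \<partial>\<mu>) = ennreal m"
    using nn_integral_gauss_funpow_transfer[OF _ g, of "\<lambda>_. 1" "Suc k"] m by simp
  have P_le: "?P x \<le> m + D / (real N + 1) ^ k" if x: "x \<in> {0<..<1}" for x
  proof -
    have "ennreal (?P x - D / (real N + 1) ^ k) = (\<integral>\<^sup>+y. ennreal (?P x - D / (real N + 1) ^ k) \<partial>\<mu>)"
      by (simp add: emeasure_space_1)
    also have "\<dots> \<le> (\<integral>\<^sup>+y. ennreal (?P y) \<partial>\<mu>)"
      using osc_bound_le[OF osc, of x] x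
      by (intro nn_integral_gauss_mono ennreal_leI) (auto simp: diff_le_eq)
    finally show ?thesis using m(2) unfolding mean by simp
  qed
  have "(\<integral>\<^sup>+x. F ((ncf_map N ^^ Suc k) x) * ennreal (g x) \<partial>\<mu>) = (\<integral>\<^sup>+x. F x * ennreal (?P x) \<partial>\<mu>)"
    by (rule nn_integral_gauss_funpow_transfer[OF _ g]) measurable
  also have "\<dots> \<le> (\<integral>\<^sup>+x. F x * ennreal (m + D / (real N + 1) ^ k) \<partial>\<mu>)"
    by (intro nn_integral_gauss_mono mult_left_mono ennreal_leI P_le) auto
  also have "\<dots> = (\<integral>\<^sup>+x. F x \<partial>\<mu>) * ennreal (m + D / (real N + 1) ^ k)"
    by (intro nn_integral_multc) measurable
  finally show ?thesis .
qed

lemma tame_ln: "tame (\<lambda>u. \<bar>ln u\<bar>)" and tame_ln_sq: "tame (\<lambda>u. \<bar>ln u\<bar> * \<bar>ln u\<bar>)"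
proof -
  have anti: "antimono_on {0<..1} (\<lambda>u::real. \<bar>ln u\<bar>)"
    by (rule monotone_onI) auto
  moreover have "antimono_on {0<..1} (\<lambda>u::real. \<bar>ln u\<bar> * \<bar>ln u\<bar>)"
    by (rule monotone_onI, rule mult_mono) (use monotone_onD[OF anti] in auto)
  ultimately show "tame (\<lambda>u. \<bar>ln u\<bar>)" "tame (\<lambda>u. \<bar>ln u\<bar> * \<bar>ln u\<bar>)"
    using sqrt_growth_ln sqrt_growth_ln_sq by (auto simp: tame_def)
qed

lemma nn_integral_gauss_ln: "(\<integral>\<^sup>+x. ennreal \<bar>ln x\<bar> \<partial>\<mu>) = ennreal (ncf_Lambda (1 / real N))"
  unfolding ncf_Lambda_def
  by (intro nn_integral_gauss_has_integral ln_kernel_has_integral N_pos) auto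

lemma ncf_Lambda_nonneg: "0 \<le> ncf_Lambda (1 / real N)"
proof -
  have "0 \<le> ncf_Theta (1 / real N)"
    by (rule has_integral_nonneg[OF ln_kernel_has_integral[OF N_pos]]) simp
  then show ?thesis unfolding ncf_Lambda_def by simp
qed

text \<open>
  Invariance reduces every product of two observables along the orbit to one with first index \<open>0\<close>;
  the strong law then applies with covariance bounds that decay geometrically.
\<close>

lemma AE_gauss_orbit_average:
  "AE x in \<mu>. (\<lambda>n. (\<Sum>k<n. \<bar>ln ((ncf_map N ^^ k) x)\<bar>) / real n) \<longlonglongrightarrow> ncf_Lambda (1 / real N)"
proof -
  interpret prob_space \<mu> by (rule prob_space_gauss)
  define m where "m = ncf_Lambda (1 / real N)"
  define Y where "Y k x = \<bar>ln ((ncf_map N ^^ k) x)\<bar>" for k x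
  define D where "D = \<bar>ncf_transfer N (\<lambda>u. \<bar>ln u\<bar>) 1 - ncf_transfer N (\<lambda>u. \<bar>ln u\<bar>) 0\<bar>"
  define Q where "Q = enn2real (\<integral>\<^sup>+x. ennreal (\<bar>ln x\<bar> * \<bar>ln x\<bar>) \<partial>\<mu>)"
  \<comment> \<open>The correlation bound carries the exponent \<open>k - 1\<close> because \<open>\<bar>ln\<bar>\<close> becomes bounded only after one transfer.\<close>
  define r where "r k = (if k = 0 then Q else m * D / (real N + 1) ^ (k - 1))" for k
  have m: "0 \<le> m" "(\<integral>\<^sup>+x. ennreal \<bar>ln x\<bar> \<partial>\<mu>) = ennreal m"
    unfolding m_def by (rule ncf_Lambda_nonneg nn_integral_gauss_ln)+
  have r_nonneg: "0 \<le> r k" for k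
    using m by (simp add: r_def Q_def D_def)
  have "summable (\<lambda>k. m * D * (1 / (real N + 1)) ^ k)"
    using N_pos by (intro summable_mult summable_geometric) simp
  then have "summable (\<lambda>k. r (Suc k))"
    by (simp add: r_def power_one_over)
  then have r_summable: "summable r" by (subst (asm) summable_Suc_iff)
  have [measurable]: "Y k \<in> borel_measurable \<mu>" for k
    unfolding Y_def by measurable
  have mean: "(\<integral>\<^sup>+x. ennreal (Y k x) \<partial>\<mu>) = ennreal m" for k
    unfolding Y_def m(2)[symmetric] by (rule nn_integral_gauss_funpow) measurable
  have corr0: "(\<integral>\<^sup>+x. ennreal (\<bar>ln ((ncf_map N ^^ k) x)\<bar> * \<bar>ln x\<bar>) \<partial>\<mu>) \<le> ennreal (m\<^sup>2 + r k)" for k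
  proof (cases k)
    case 0
    have "(\<integral>\<^sup>+x. ennreal (\<bar>ln x\<bar> * \<bar>ln x\<bar>) \<partial>\<mu>) = ennreal Q"
      unfolding Q_def using nn_integral_gauss_finite[OF tame_ln_sq] by simp
    also have "\<dots> \<le> ennreal (m\<^sup>2 + r k)" using 0 by (intro ennreal_leI) (simp add: r_def)
    finally show ?thesis using 0 by simp
  next
    case (Suc l)
    have "(\<integral>\<^sup>+x. ennreal \<bar>ln ((ncf_map N ^^ Suc l) x)\<bar> * ennreal \<bar>ln x\<bar> \<partial>\<mu>)
        \<le> (\<integral>\<^sup>+x. ennreal \<bar>ln x\<bar> \<partial>\<mu>) * ennreal (m + D / (real N + 1) ^ l)"
      unfolding D_def using m
      by (intro nn_integral_gauss_correlation[where F = "\<lambda>x. ennreal \<bar>ln x\<bar>"] tame_ln) auto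
    also have "\<dots> = ennreal (m\<^sup>2 + r k)"
      using m Suc by (simp add: ennreal_mult'[symmetric] r_def power2_eq_square algebra_simps)
    finally show ?thesis using Suc by (simp add: ennreal_mult')
  qed
  have corr: "(\<integral>\<^sup>+x. ennreal (Y i x * Y j x) \<partial>\<mu>) \<le> ennreal (m\<^sup>2 + r (j - i))" if "i \<le> j" for i j
  proof -
    define F where "F x = ennreal (\<bar>ln ((ncf_map N ^^ (j - i)) x)\<bar> * \<bar>ln x\<bar>)" for x
    have [measurable]: "F \<in> borel_measurable borel" unfolding F_def by measurable
    have "ncf_map N ^^ j = (ncf_map N ^^ (j - i)) \<circ> (ncf_map N ^^ i)"
      using that by (simp flip: funpow_add)
    then have "(\<integral>\<^sup>+x. ennreal (Y i x * Y j x) \<partial>\<mu>) = (\<integral>\<^sup>+x. F ((ncf_map N ^^ i) x) \<partial>\<mu>)"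
      by (simp add: Y_def F_def mult.commute)
    also have "\<dots> = (\<integral>\<^sup>+x. F x \<partial>\<mu>)"
      by (rule nn_integral_gauss_funpow) measurable
    finally show ?thesis using corr0 by (simp add: F_def)
  qed
  have bounded: "integrable \<mu> Z \<and> expectation Z \<le> c"
    if [measurable]: "Z \<in> borel_measurable \<mu>" and Z: "\<And>x. 0 \<le> Z x"
      "(\<integral>\<^sup>+x. ennreal (Z x) \<partial>\<mu>) \<le> ennreal c" "0 \<le> c" for Z c
  proof
    show int: "integrable \<mu> Z"
      using Z by (intro integrableI_nonneg) (auto intro: le_less_trans)
    show "expectation Z \<le> c"
      using nn_integral_eq_integral[OF int] Z by simp
  qed
  have "AE x in \<mu>. (\<lambda>n. (\<Sum>i<n. Y i x) / real n) \<longlonglongrightarrow> m"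
  proof (rule strong_law_summable_covariance[where r = r])
    show "integrable \<mu> (Y i)" for i
      using bounded[of "Y i" m] mean m by (auto simp: Y_def)
    then show "expectation (Y i) = m" for i
      using mean[of i] m by (subst (asm) nn_integral_eq_integral) (auto simp: Y_def)
    fix i j :: nat assume "i \<le> j"
    have "0 \<le> m\<^sup>2 + r (j - i)" using r_nonneg by simp
    with corr[OF \<open>i \<le> j\<close>] show "integrable \<mu> (\<lambda>x. Y i x * Y j x)"
      "expectation (\<lambda>x. Y i x * Y j x) \<le> m\<^sup>2 + r (j - i)"
      using bounded[of "\<lambda>x. Y i x * Y j x" "m\<^sup>2 + r (j - i)"] by (auto simp: Y_def)
  qed (auto simp: r_nonneg r_summable, simp_all add: Y_def)
  then show ?thesis by (simp add: Y_def m_def)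
qed

end

section \<open>Growth of the denominators\<close>

theorem theorem5p2:
  fixes N :: nat
  assumes "N > 0"
  shows "AE x in lebesgue_on {0..<1}.
    (\<lambda>n. ln (real (ncf_den N x n)) / real n)
      \<longlonglongrightarrow> ncf_Lambda (1 / real N) + ln (real N)"
proof -
  have limit: "(\<lambda>n. ln (real (ncf_den N x n)) / real n) \<longlonglongrightarrow> ncf_Lambda (1 / real N) + ln (real N)"
    if x: "x \<in> {0<..<1}" "x \<notin> \<rat>"
      and lim: "(\<lambda>n. (\<Sum>k<n. \<bar>ln ((ncf_map N ^^ k) x)\<bar>) / real n) \<longlonglongrightarrow> ncf_Lambda (1 / real N)" for x
  proof -
    let ?S = "\<lambda>n. \<Sum>k<n. \<bar>ln ((ncf_map N ^^ k) x)\<bar>"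
    let ?R = "\<lambda>n. ln (real (ncf_den N x n)) - (real n * ln (real N) + ?S n)"
    have "(\<lambda>n. ?R n / real n) \<longlonglongrightarrow> 0"
    proof (rule Lim_null_comparison)
      show "\<forall>\<^sub>F n in sequentially. norm (?R n / real n) \<le> ln 2 / real n"
        using ln_ncf_den_orbit_sum[OF assms x] by (auto simp: divide_right_mono)
      show "(\<lambda>n. ln 2 / real n) \<longlonglongrightarrow> 0" by real_asymp
    qed
    from tendsto_add[OF tendsto_add[OF lim this] tendsto_const[of "ln (real N)"]]
    have "(\<lambda>n. ?S n / real n + ?R n / real n + ln (real N)) \<longlonglongrightarrow> ncf_Lambda (1 / real N) + ln (real N)"
      by simp
    then show ?thesis
    proof (rule Lim_transform_eventually)
      show "\<forall>\<^sub>F n in sequentially. ?S n / real n + ?R n / real n + ln (real N) = ln (real (ncf_den N x n)) / real n"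
        using eventually_gt_at_top[of 0]
        by eventually_elim (simp add: add_divide_distrib diff_divide_distrib)
    qed
  qed
  \<comment> \<open>Rational points are discarded, since their orbits reach \<open>0\<close>.\<close>
  have "AE x in lborel. x \<notin> (\<rat> :: real set)"
    by (intro AE_not_in countable_imp_null_set_lborel countable_rat)
  moreover have "AE x in lborel. x \<in> {0<..<1} \<longrightarrow>
      (\<lambda>n. (\<Sum>k<n. \<bar>ln ((ncf_map N ^^ k) x)\<bar>) / real n) \<longlonglongrightarrow> ncf_Lambda (1 / real N)"
    using AE_gauss_orbit_average[OF assms] by (simp only: AE_gauss_iff[OF assms])
  ultimately have "AE x in lborel. x \<in> {0..<1} \<longrightarrow>
      (\<lambda>n. ln (real (ncf_den N x n)) / real n) \<longlonglongrightarrow> ncf_Lambda (1 / real N) + ln (real N)"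
  proof eventually_elim
    case (elim x)
    then have "x \<noteq> 0" by auto
    then show ?case using elim limit[of x] by auto
  qed
  then have "AE x in lebesgue. x \<in> {0..<1} \<longrightarrow>
      (\<lambda>n. ln (real (ncf_den N x n)) / real n) \<longlonglongrightarrow> ncf_Lambda (1 / real N) + ln (real N)"
    by (rule AE_completion)
  then show ?thesis by (subst AE_restrict_space_iff) auto
qed

end
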